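(* Let $f:S^2\to\mathbb{R}^3$ be a $C^1$ embedding satisfying $f(-u)=-f(u)$ for all $u\in S^2$. Suppose further that $f$ is homotopic to the standard embedding $S^2\hookrightarrow\mathbb{R}^3$ via a $C^1$ homotopy $H:S^2\times[0,1]\to\mathbb{R}^3\setminus\{0\}$ satisfying $H(-u,t)=-H(u,t)$ for all $u\in S^2$ and $t\in[0,1]$. Then for any given ratio $q>0$ there is a square based box in $\mathbb{R}^3$, with its centre at the origin and with ratio of the height to the basic edge equal to $q$, having all its vertices on the surface $f(S^2)$.
   Context: $S^2$ is the unit sphere of $\mathbb{R}^3$ and the standard embedding is the inclusion map $u\mapsto u$. That $H$ is a homotopy between $f$ and the standard embedding means $H(u,0)=f(u)$ and $H(u,1)=u$ for all $u\in S^2$. A box is a (non-degenerate) rectangular parallelepiped, in arbitrary orientation; a square based box with ratio of height to basic edge $q$ is one with edge lengths $a,a,qa$ for some $a>0$. *)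

theory Defs
  imports "HOL-Analysis.Analysis"
begin

(* C^1 maps on a subset S of a normed space that need not be open (here S^2 and S^2 x [0,1],
   embedded as submanifolds, with boundary in the second case): near each point of S the map is
   the restriction of a continuously differentiable map on an open set of the ambient space.
   The derivative is continuous for the operator norm. *)
definition C1_on :: "'a::real_normed_vector set \<Rightarrow> ('a \<Rightarrow> 'b::real_normed_vector) \<Rightarrow> bool" where
  "C1_on S f \<longleftrightarrow>
     (\<forall>x\<in>S. \<exists>U g g'. open U \<and> x \<in> U \<and>
        (\<forall>y\<in>U. (g has_derivative blinfun_apply (g' y)) (at y)) \<and> continuous_on U g' \<and>
        (\<forall>y\<in>S \<inter> U. f y = g y))"

(* The set of all v with u \<bullet> v = 0 is the tangent plane of S^2 at u. A derivative D within the
   sphere is not unique, but its restriction to this plane is: it is the differential of f at u. *)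
definition C1_embedding_sphere :: "(real^3 \<Rightarrow> real^3) \<Rightarrow> bool" where
  "C1_embedding_sphere f \<longleftrightarrow>
     C1_on (sphere 0 1) f \<and>
     (\<forall>u\<in>sphere 0 1. \<exists>D. (f has_derivative D) (at u within sphere 0 1) \<and>
        inj_on D {v. u \<bullet> v = 0}) \<and>
     (\<exists>g. homeomorphism (sphere 0 1) (f ` sphere 0 1) f g)"

(* The solid box with centre c and edge lengths l$1, l$2, l$3, in arbitrary orientation. *)
definition is_box :: "real^3 \<Rightarrow> real^3 \<Rightarrow> (real^3) set \<Rightarrow> bool" where
  "is_box c l B \<longleftrightarrow>
     (\<forall>i. 0 < l $ i) \<and>
     (\<exists>T. orthogonal_transformation T \<and>
        B = (\<lambda>x. c + T x) ` cbox (- ((1/2) *\<^sub>R l)) ((1/2) *\<^sub>R l))"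

definition square_based_box :: "real \<Rightarrow> real^3 \<Rightarrow> (real^3) set \<Rightarrow> bool" where
  "square_based_box q c B \<longleftrightarrow> (\<exists>a>0. is_box c (vector [a, a, q * a]) B)"

definition vertices :: "(real^3) set \<Rightarrow> (real^3) set" where
  "vertices B = {x. x extreme_point_of B}"

end

theory Submission
  imports Defs "HOL-Library.Z2" "HOL-Library.Multiset"
begin

text \<open>
  The surface \<open>S = f(S\<^sup>2)\<close> is compact,
  symmetric and misses the origin, and the homotopy, divided by its norm, shows that \<open>f / |f|\<close>
  is homotopic to the identity of the sphere, hence essential; by Borsuk's criterion the origin
  lies in a bounded component of the complement of \<open>S\<close>
  (\<open>bounded_component_of_homotopic_sphere\<close>). The distance to \<open>S\<close>, taken with a minus sign
  on that component, is therefore an even continuous function that is negative at the origin,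
  at least 1 far away, and zero exactly on \<open>S\<close>. It remains to show that every such function
  \<open>\<phi>\<close> vanishes at all eight vertices of some box of the prescribed shape centred at the
  origin (\<open>balanced_box_exists\<close>).

  These boxes are parametrised by nonzero quaternions \<open>w\<close>, through
  \<open>v \<mapsto> w v w\<^sup>*\<close>, which rotates the space of pure quaternions and scales it by
  \<open>|w|\<^sup>2\<close>. Up to sign a box has four vertices, indexed by the fourth roots of unity
  \<open>\<zeta>\<close>; let \<open>\<psi> \<zeta> w\<close> be the value of \<open>\<phi>\<close> there. Right
  multiplication by the binary dihedral group of order 16 permutes the vertices of a box, so the map
  \<open>\<psi>\<close> from \<open>\<real>\<^sup>4\<close> to \<open>\<real>\<^sup>4\<close> is equivariant. It is negative in
  every coordinate at 0 and positive far away. That it has a zero is a mod 2 statement: the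
  orbits of zeros of a generic such map are odd in number (for an ellipsoid there are three, one for
  each axis).

  The parity is reached combinatorially. If \<open>\<psi>\<close> has no zero, then near every point one
  of the four linear combinations \<open>s\<close> (the sum), \<open>c\<close> (the alternating sum),
  \<open>\<psi> 1 - \<psi> (-1)\<close> and \<open>\<psi> \<i> - \<psi> (-\<i>)\<close> is bounded away
  from 0. Recording which one, and its sign, labels each point by a vertex of the
  4-dimensional cross-polytope; nearby points never receive opposite labels, the labelling can be
  chosen equivariantly, the origin is labelled \<open>SN\<close> and far points \<open>SP\<close>.
  On a fine subdivision this is an equivariant simplicial map to the boundary of the
  cross-polytope. On that boundary there are explicit mod 2 cochains in the degrees from 0 to 3
  whose coboundaries are sums of translates of those in the next degree (\<open>cobd_point_cochain\<close> up
  to \<open>cobd_top_cochain\<close>). Evaluated on the cone over a fundamental domain of the group in the join of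
  two octagons, these identities unwind, dimension by dimension, to the equality of the values of
  the 0-cochain at a far point and at the origin; but these values are 1 and 0
  (\<open>equivariant_labelling.contradiction\<close>).

  Subdivision enters in dual form: instead of subdividing chains, the operator \<open>subdiv\<close>
  pulls back cochains. It commutes with the coboundary and with linear maps, and its iterates see
  only small simplices (\<open>subdiv_pow_local\<close>).
\<close>

section \<open>Mod 2 cochains on multisets of points\<close>

text \<open>The simplifier is to treat the field with two elements as an additive group in which
  equal summands cancel, instead of turning sums into Boolean expressions.\<close>

declare add_bit_eq_xor [simp del] mult_bit_eq_and [simp del]
  bit_not_zero_iff [simp del] bit_not_one_iff [simp del]

lemma bit_add_self [simp]: "(b::bit) + b = 0"
  by (cases b) auto

lemma bit_add_self_left [simp]: "(b::bit) + (b + c) = c"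
  by (simp flip: add.assoc)

lemma bit_add_eq_0_iff: "(a::bit) + b = 0 \<longleftrightarrow> a = b"
  by (cases a; cases b) simp_all

text \<open>A simplex is the multiset of its vertices, and a cochain is any function of
  multisets. Degenerate simplices are kept: a repeated vertex contributes two equal faces,
  which cancel mod 2, so neither orderings nor orientations are needed.\<close>

definition cobd :: "('a multiset \<Rightarrow> bit) \<Rightarrow> 'a multiset \<Rightarrow> bit" where
  "cobd f M = (\<Sum>a\<in>#M. f (M - {#a#}))"

text \<open>The coboundary on a cone is the base plus the cone over the coboundary. All computations
  with coboundaries below, including \<open>\<delta> \<delta> = 0\<close>, come from this recursion.\<close>

lemma cobd_add_mset: "cobd f (add_mset b M) = f M + cobd (\<lambda>N. f (add_mset b N)) M"
proof -
  have "add_mset b M - {#a#} = add_mset b (M - {#a#})" if "a \<in># M" for a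
    using that by (simp add: insert_DiffM multiset_eq_iff)
  then have "(\<Sum>a\<in>#M. f (add_mset b M - {#a#})) = (\<Sum>a\<in>#M. f (add_mset b (M - {#a#})))"
    by (intro arg_cong[where f=sum_mset] image_mset_cong) simp
  then show ?thesis by (simp add: cobd_def)
qed

lemma cobd_empty [simp]: "cobd f {#} = 0"
  by (simp add: cobd_def)

lemma cobd_plus: "cobd (\<lambda>M. f M + g M) M = cobd f M + cobd g M"
  by (simp add: cobd_def sum_mset.distrib)

lemma cobd_cobd: "cobd (cobd f) M = 0"
proof (induction M arbitrary: f)
  case (add b M)
  have "cobd (cobd f) (add_mset b M) =
      cobd f M + cobd (\<lambda>N. f N + cobd (\<lambda>N. f (add_mset b N)) N) M"
    by (simp add: cobd_add_mset)
  also have "\<dots> = 0"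
    by (simp add: cobd_plus add.IH)
  finally show ?case .
qed simp

lemma cobd_image_mset: "cobd (\<lambda>N. f (image_mset l N)) M = cobd f (image_mset l M)"
proof (induction M arbitrary: f)
  case (add b M)
  show ?case using add.IH[of "\<lambda>N. f (add_mset (l b) N)"] by (simp add: cobd_add_mset)
qed simp

definition barycentre :: "'a::real_vector multiset \<Rightarrow> 'a" where
  "barycentre M = (1 / real (size M)) *\<^sub>R \<Sum>\<^sub># M"

text \<open>The dual of barycentric subdivision. A cochain is evaluated on the subdivision of a
  simplex by coning every face from the barycentre and recursing into the faces; the number
  counts the dimension down.\<close>

primrec subdiv_aux :: "nat \<Rightarrow> ('a::real_vector multiset \<Rightarrow> bit) \<Rightarrow> 'a multiset \<Rightarrow> bit" where
  "subdiv_aux 0 f M = f M"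
| "subdiv_aux (Suc k) f M =
     (\<Sum>a\<in>#M. subdiv_aux k (\<lambda>N. f (add_mset (barycentre M) N)) (M - {#a#}))"

definition subdiv :: "('a::real_vector multiset \<Rightarrow> bit) \<Rightarrow> 'a multiset \<Rightarrow> bit" where
  "subdiv f M = subdiv_aux (size M - 1) f M"

lemma subdiv_aux_plus:
  "subdiv_aux k (\<lambda>M. f M + g M) M = subdiv_aux k f M + subdiv_aux k g M"
  by (induction k arbitrary: f g M) (simp_all add: sum_mset.distrib)

text \<open>Coning with the barycentre splits \<open>\<delta> f\<close> into \<open>f\<close> and a coboundary
  \<open>\<delta> g\<close>. Summed over the faces of \<open>M\<close>, the first part gives the
  right-hand side; the second vanishes by induction and \<open>\<delta> \<delta> = 0\<close>.\<close>

lemma subdiv_aux_cobd: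
  "size M = Suc (Suc k) \<Longrightarrow> subdiv_aux (Suc k) (cobd f) M = cobd (subdiv_aux k f) M"
proof (induction k arbitrary: f M)
  case 0
  obtain u M' where u: "M = add_mset u M'"
    using size_eq_Suc_imp_eq_union[OF 0] by blast
  with 0 have "size M' = 1" by simp
  then obtain v where "M' = {#v#}"
    by (rule size_1_singleton_mset[THEN exE])
  with u have M: "M = {#u, v#}" by simp
  define b where "b = barycentre M"
  have "subdiv_aux (Suc 0) (cobd f) M = cobd f {#b, v#} + cobd f {#b, u#}"
    by (simp add: M flip: b_def[unfolded M])
  also have "\<dots> = f {#v#} + f {#u#}"
    by (simp add: cobd_add_mset ac_simps)
  finally show ?case by (simp add: M cobd_add_mset add.commute)
next
  case (Suc k)
  define b where "b = barycentre M"
  define g where "g = (\<lambda>N. f (add_mset b N))"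
  have "subdiv_aux (Suc (Suc k)) (cobd f) M =
      (\<Sum>a\<in>#M. subdiv_aux (Suc k) (\<lambda>N. f N + cobd g N) (M - {#a#}))"
    by (simp add: g_def cobd_add_mset flip: b_def del: subdiv_aux.simps(2))
       (simp add: g_def cobd_add_mset flip: b_def)
  also have "\<dots> = (\<Sum>a\<in>#M. subdiv_aux (Suc k) f (M - {#a#})) +
      (\<Sum>a\<in>#M. subdiv_aux (Suc k) (cobd g) (M - {#a#}))"
    by (simp add: subdiv_aux_plus sum_mset.distrib del: subdiv_aux.simps)
  also have "(\<Sum>a\<in>#M. subdiv_aux (Suc k) (cobd g) (M - {#a#})) =
      (\<Sum>a\<in>#M. cobd (subdiv_aux k g) (M - {#a#}))"
    using Suc by (intro arg_cong[where f=sum_mset] image_mset_cong Suc.IH)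
                 (simp add: size_Diff_singleton)
  also have "\<dots> = 0"
    using cobd_cobd[of "subdiv_aux k g" M] by (simp add: cobd_def)
  finally show ?case by (simp add: cobd_def del: subdiv_aux.simps)
qed

lemma subdiv_cobd:
  assumes "2 \<le> size M"
  shows "subdiv (cobd f) M = cobd (subdiv f) M"
proof -
  obtain k where k: "size M = Suc (Suc k)"
    using le_Suc_ex[OF assms] by auto
  have "cobd (subdiv_aux k f) M = cobd (subdiv f) M"
    unfolding cobd_def
    by (intro arg_cong[where f=sum_mset] image_mset_cong)
       (simp add: subdiv_def k size_Diff_singleton)
  then show ?thesis
    using subdiv_aux_cobd[OF k, of f] by (simp add: subdiv_def k)
qed

lemma barycentre_image:
  assumes "linear A"
  shows "barycentre (image_mset A M) = A (barycentre M)"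
proof -
  interpret linear A by fact
  have "\<Sum>\<^sub># (image_mset A M) = A (\<Sum>\<^sub># M)"
    by (induction M) (simp_all add: add)
  then show ?thesis by (simp add: barycentre_def scale)
qed

lemma image_mset_remove1: "a \<in># M \<Longrightarrow> image_mset g M - {#g a#} = image_mset g (M - {#a#})"
  by (auto dest: multi_member_split)

lemma subdiv_aux_linear:
  assumes "linear A"
  shows "subdiv_aux k f (image_mset A M) = subdiv_aux k (\<lambda>N. f (image_mset A N)) M"
proof (induction k arbitrary: f M)
  case (Suc k)
  show ?case
    unfolding subdiv_aux.simps image_mset.compositionality o_def
    by (intro arg_cong[where f=sum_mset] image_mset_cong)
       (simp add: image_mset_remove1 Suc.IH barycentre_image[OF assms])
qed simp

lemma subdiv_linear:
  "linear A \<Longrightarrow> subdiv f (image_mset A M) = subdiv (\<lambda>N. f (image_mset A N)) M"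
  by (simp add: subdiv_def subdiv_aux_linear)

lemma subdiv_aux_cong:
  assumes "\<And>N. size N = size M \<Longrightarrow> f N = g N" "size M = Suc k"
  shows "subdiv_aux k f M = subdiv_aux k g M"
  using assms
proof (induction k arbitrary: f g M)
  case (Suc k)
  then show ?case
    unfolding subdiv_aux.simps
    by (intro arg_cong[where f=sum_mset] image_mset_cong Suc.IH) (auto simp: size_Diff_singleton)
qed simp

lemma subdiv_cong:
  assumes "\<And>N. size N = size M \<Longrightarrow> f N = g N" "M \<noteq> {#}"
  shows "subdiv f M = subdiv g M"
  unfolding subdiv_def using assms
  by (intro subdiv_aux_cong) (auto simp: nonempty_has_size)

lemma norm_sum_mset_le:
  fixes g :: "'b \<Rightarrow> 'a::real_normed_vector"
  assumes "\<And>x. x \<in># M \<Longrightarrow> norm (g x) \<le> D"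
  shows "norm (\<Sum>x\<in>#M. g x) \<le> real (size M) * D"
  using assms
proof (induction M)
  case (add x M)
  have "norm (\<Sum>x\<in>#add_mset x M. g x) \<le> norm (g x) + norm (\<Sum>x\<in>#M. g x)"
    by (simp add: norm_triangle_ineq)
  also have "\<dots> \<le> D + real (size M) * D"
    using add by (intro add_mono) auto
  finally show ?case by (simp add: algebra_simps)
qed simp

lemma barycentre_in_hull:
  fixes M :: "'a::real_vector multiset"
  assumes "M \<noteq> {#}"
  shows "barycentre M \<in> convex hull set_mset M"
proof -
  have "\<exists>c\<in>C. \<Sum>\<^sub># M = real (size M) *\<^sub>R c" if "convex C" "set_mset M \<subseteq> C" for C
    using assms that(2)
  proof (induction M)
    case (add x M)
    show ?case
    proof (cases "M = {#}")
      case False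
      then obtain c where c: "c \<in> C" "\<Sum>\<^sub># M = real (size M) *\<^sub>R c"
        using add by auto
      define n where "n = real (size M)"
      have "(1 / (1 + n)) *\<^sub>R x + (n / (1 + n)) *\<^sub>R c \<in> C"
        using add.prems c by (intro convexD[OF \<open>convex C\<close>]) (auto simp: n_def field_simps)
      moreover have "\<Sum>\<^sub># (add_mset x M) =
          real (size (add_mset x M)) *\<^sub>R ((1 / (1 + n)) *\<^sub>R x + (n / (1 + n)) *\<^sub>R c)"
        using c(2) by (simp add: n_def scaleR_add_right)
      ultimately show ?thesis by blast
    qed (use add in auto)
  qed simp
  from this[of "convex hull set_mset M"] show ?thesis
    using assms by (auto simp: barycentre_def hull_subset)
qed

text \<open>The barycentre of \<open>k + 1\<close> points is off each vertex by an average of \<open>k + 1\<close>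
  differences, one of which is zero; balls being convex, the bound passes to the hull.\<close>

lemma dist_barycentre_le:
  fixes M :: "'a::real_normed_vector multiset"
  assumes "size M = Suc k" and D: "\<And>p q. p \<in># M \<Longrightarrow> q \<in># M \<Longrightarrow> dist p q \<le> D"
    and x: "x \<in> convex hull set_mset M"
  shows "dist (barycentre M) x \<le> real k / real (Suc k) * D"
proof -
  have "q \<in> cball (barycentre M) (real k / real (Suc k) * D)" if q: "q \<in># M" for q
  proof -
    obtain N where N: "M = add_mset q N"
      using q by (metis insert_DiffM)
    have "(\<Sum>p\<in>#N. p - q) = \<Sum>\<^sub># N - real (size N) *\<^sub>R q"
      by (induction N) (simp_all add: algebra_simps)
    moreover have k: "size N = k" using assms(1) N by simp
    ultimately have "(\<Sum>p\<in>#N. p - q) = real (Suc k) *\<^sub>R (barycentre M - q)"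
      by (simp add: barycentre_def N scaleR_diff_right scaleR_add_left)
    then have "barycentre M - q = (1 / real (Suc k)) *\<^sub>R (\<Sum>p\<in>#N. p - q)"
      by simp
    then have "norm (barycentre M - q) = norm (\<Sum>p\<in>#N. p - q) / real (Suc k)"
      by (metis norm_scaleR abs_divide abs_one abs_of_nat mult.left_neutral times_divide_eq_left)
    moreover have "norm (\<Sum>p\<in>#N. p - q) \<le> real k * D"
      using norm_sum_mset_le[of N "\<lambda>p. p - q" D] D q N k by (simp add: dist_norm)
    ultimately show ?thesis
      by (simp add: dist_norm divide_right_mono del: of_nat_Suc)
  qed
  then have "convex hull set_mset M \<subseteq> cball (barycentre M) (real k / real (Suc k) * D)"
    by (intro hull_minimal) auto
  then show ?thesis using x by auto
qed

text \<open>Subdividing once shrinks the diameter of a \<open>k\<close>-simplex by the factor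
  \<open>k / (k + 1)\<close>, so the subdivided cochain is determined by its values on
  simplices of that size inside the hull.\<close>

lemma subdiv_aux_local:
  fixes M :: "'a::real_normed_vector multiset"
  assumes "size M = Suc k" and "\<And>p q. p \<in># M \<Longrightarrow> q \<in># M \<Longrightarrow> dist p q \<le> D"
    and "real k / real (Suc k) * D \<le> E"
    and "\<And>N. size N = Suc k \<Longrightarrow> set_mset N \<subseteq> convex hull set_mset M \<Longrightarrow>
            (\<And>p q. p \<in># N \<Longrightarrow> q \<in># N \<Longrightarrow> dist p q \<le> E) \<Longrightarrow> f N = g N"
  shows "subdiv_aux k f M = subdiv_aux k g M"
  using assms
proof (induction k arbitrary: f g M)
  case 0
  then obtain v where "M = {#v#}" using size_1_singleton_mset[of M] by auto
  then show ?case using "0.prems"(3) by (auto intro!: "0.prems"(4))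
next
  case (Suc k)
  define b where "b = barycentre M"
  have ne: "M \<noteq> {#}" using Suc.prems(1) by auto
  have b: "b \<in> convex hull set_mset M"
    unfolding b_def by (rule barycentre_in_hull[OF ne])
  have bE: "dist b x \<le> E" if "x \<in> convex hull set_mset M" for x
    using dist_barycentre_le[OF Suc.prems(1,2) that] Suc.prems(3) by (simp add: b_def)
  have "D \<ge> 0"
    using ne Suc.prems(2) by (metis dist_self multiset_nonemptyE)
  then have "real k / real (Suc k) * D \<le> real (Suc k) / real (Suc (Suc k)) * D"
    by (intro mult_right_mono) (simp_all add: field_simps)
  with Suc.prems(3) have E: "real k / real (Suc k) * D \<le> E" by linarith
  have "subdiv_aux k (\<lambda>N. f (add_mset b N)) (M - {#a#}) =
        subdiv_aux k (\<lambda>N. g (add_mset b N)) (M - {#a#})" if a: "a \<in># M" for a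
  proof (rule Suc.IH)
    show "size (M - {#a#}) = Suc k" using a Suc.prems(1) by (simp add: size_Diff_singleton)
    show "dist p q \<le> D" if "p \<in># M - {#a#}" "q \<in># M - {#a#}" for p q
      using that Suc.prems(2) by (meson in_diffD)
    show "real k / real (Suc k) * D \<le> E" by fact
    fix N assume N: "size N = Suc k" "set_mset N \<subseteq> convex hull set_mset (M - {#a#})"
      "\<And>p q. p \<in># N \<Longrightarrow> q \<in># N \<Longrightarrow> dist p q \<le> E"
    have "convex hull set_mset (M - {#a#}) \<subseteq> convex hull set_mset M"
      by (intro hull_mono) (meson in_diffD subsetI)
    with N(2) have N': "set_mset N \<subseteq> convex hull set_mset M" by blast
    have "E \<ge> 0" using bE[OF b] by simp
    then show "f (add_mset b N) = g (add_mset b N)"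
      using N N' b bE by (intro Suc.prems(4)) (auto simp: dist_commute subset_iff)
  qed
  then show ?case
    by (auto simp flip: b_def intro!: arg_cong[where f=sum_mset] image_mset_cong)
qed

lemma subdiv_pow_local:
  fixes M :: "'a::real_normed_vector multiset"
  assumes "M \<noteq> {#}" "size M \<le> m" and "\<And>p q. p \<in># M \<Longrightarrow> q \<in># M \<Longrightarrow> dist p q \<le> D"
    and "\<And>N. size N = size M \<Longrightarrow> set_mset N \<subseteq> convex hull set_mset M \<Longrightarrow>
            (\<And>p q. p \<in># N \<Longrightarrow> q \<in># N \<Longrightarrow> dist p q \<le> (1 - 1 / real m) ^ n * D) \<Longrightarrow> f N = g N"
  shows "(subdiv ^^ n) f M = (subdiv ^^ n) g M"
  using assms
proof (induction n arbitrary: M D)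
  case 0
  show ?case using "0.prems"(3) by (auto intro!: "0.prems"(4) hull_inc)
next
  case (Suc n)
  obtain k where k: "size M = Suc k" using Suc.prems(1) by (cases "size M") auto
  have "D \<ge> 0"
    using Suc.prems(1,3) by (metis dist_self multiset_nonemptyE)
  have "1 / real m \<le> 1 / real (Suc k)"
    using Suc.prems(2) k by (intro divide_left_mono) auto
  then have "real k / real (Suc k) \<le> 1 - 1 / real m"
    by (simp add: field_simps)
  then have E: "real k / real (Suc k) * D \<le> (1 - 1 / real m) * D"
    using \<open>D \<ge> 0\<close> by (intro mult_right_mono)
  have "subdiv_aux k ((subdiv ^^ n) f) M = subdiv_aux k ((subdiv ^^ n) g) M"
  proof (rule subdiv_aux_local[OF k Suc.prems(3) E], assumption, assumption)
    fix N assume N: "size N = Suc k" "set_mset N \<subseteq> convex hull set_mset M"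
      "\<And>p q. p \<in># N \<Longrightarrow> q \<in># N \<Longrightarrow> dist p q \<le> (1 - 1 / real m) * D"
    show "(subdiv ^^ n) f N = (subdiv ^^ n) g N"
    proof (rule Suc.IH[OF _ _ N(3)])
      fix N' assume N': "size N' = size N" "set_mset N' \<subseteq> convex hull set_mset N"
        "\<And>p q. p \<in># N' \<Longrightarrow> q \<in># N' \<Longrightarrow> dist p q \<le> (1 - 1 / real m) ^ n * ((1 - 1 / real m) * D)"
      have "convex hull set_mset N \<subseteq> convex hull set_mset M"
        using N(2) by (rule hull_minimal) simp
      then show "f N' = g N'"
        using N N' k by (intro Suc.prems(4)) (auto simp: mult_ac)
    qed (use N k Suc.prems in auto)
  qed
  then show ?case by (simp add: subdiv_def[of _ M] k)
qed

lemma subdiv_pow_cobd: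
  "2 \<le> size M \<Longrightarrow> (subdiv ^^ n) (cobd f) M = cobd ((subdiv ^^ n) f) M"
proof (induction n arbitrary: M)
  case (Suc n)
  have "(subdiv ^^ Suc n) (cobd f) M = subdiv (cobd ((subdiv ^^ n) f)) M"
    using Suc by (auto intro!: subdiv_cong)
  then show ?case using Suc.prems by (simp add: subdiv_cobd)
qed simp

lemma subdiv_plus: "subdiv (\<lambda>M. f M + g M) = (\<lambda>M. subdiv f M + subdiv g M)"
  by (simp add: subdiv_def subdiv_aux_plus fun_eq_iff)

lemma subdiv_pow_plus:
  "(subdiv ^^ n) (\<lambda>M. f M + g M) = (\<lambda>M. (subdiv ^^ n) f M + (subdiv ^^ n) g M)"
  by (induction n) (simp_all add: subdiv_plus)

lemma subdiv_pow_zero: "(subdiv ^^ n) (\<lambda>_. 0) M = 0"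
  using fun_cong[OF subdiv_pow_plus[of n "\<lambda>_. 0" "\<lambda>_. 0"], of M] by simp

lemma subdiv_pow_linear:
  assumes "linear A"
  shows "(subdiv ^^ n) f (image_mset A M) = (subdiv ^^ n) (\<lambda>N. f (image_mset A N)) M"
  by (induction n arbitrary: M) (simp_all add: subdiv_linear[OF assms])

text \<open>Subdivision does nothing to a point, so values at the two ends of a chain of
  identities can be read off directly.\<close>

lemma subdiv_pow_singleton: "(subdiv ^^ n) f {#v#} = f {#v#}"
  by (induction n) (simp_all add: subdiv_def)

section \<open>Cochains on the sphere of labels\<close>

text \<open>The vertices of the cross-polytope: \<open>SP\<close>, \<open>SN\<close> and \<open>CP\<close>, \<open>CN\<close>
  stand for the signs of the sum and of the alternating sum, and \<open>V0\<close>, ..., \<open>V3\<close>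
  for the four directions \<open>1\<close>, \<open>\<i>\<close>, \<open>-1\<close>, \<open>-\<i>\<close>.\<close>

datatype label = SP | SN | CP | CN | V0 | V1 | V2 | V3

lemma UNIV_label: "UNIV = {SP, SN, CP, CN, V0, V1, V2, V3}"
  using label.exhaust by auto

instance label :: finite
  by standard (simp add: UNIV_label)

fun opposite :: "label \<Rightarrow> label" where
  "opposite SP = SN" | "opposite SN = SP" | "opposite CP = CN" | "opposite CN = CP"
| "opposite V0 = V2" | "opposite V1 = V3" | "opposite V2 = V0" | "opposite V3 = V1"

text \<open>Compatible multisets are the simplices of the boundary of the cross-polytope.\<close>

definition compatible :: "label multiset \<Rightarrow> bool" where
  "compatible M \<longleftrightarrow> (\<forall>a\<in>#M. opposite a \<notin># M)"

text \<open>The action of two generators of the dihedral group on labels. A turn rotates the base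
  square, so it exchanges the two diagonals and flips the alternating sum; \<open>swap_label\<close> below
  reflects the square in one of its diagonals.\<close>

fun turn_label :: "label \<Rightarrow> label" where
  "turn_label SP = SP" | "turn_label SN = SN" | "turn_label CP = CN" | "turn_label CN = CP"
| "turn_label V0 = V3" | "turn_label V1 = V0" | "turn_label V2 = V1" | "turn_label V3 = V2"

fun turn_label' :: "label \<Rightarrow> label" where
  "turn_label' SP = SP" | "turn_label' SN = SN" | "turn_label' CP = CN" | "turn_label' CN = CP"
| "turn_label' V3 = V0" | "turn_label' V0 = V1" | "turn_label' V1 = V2" | "turn_label' V2 = V3"

fun swap_label :: "label \<Rightarrow> label" where
  "swap_label SP = SP" | "swap_label SN = SN" | "swap_label CP = CP" | "swap_label CN = CN"
| "swap_label V0 = V2" | "swap_label V1 = V1" | "swap_label V2 = V0" | "swap_label V3 = V3"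

definition ind :: "'a multiset \<Rightarrow> 'a multiset \<Rightarrow> bit" where
  "ind s M = of_bool (M = s)"

lemma ind_self [simp]: "ind s s = 1"
  by (simp add: ind_def)

lemma ind_image_mset:
  assumes "\<And>a. g (g' a) = a" "\<And>a. g' (g a) = a"
  shows "ind s (image_mset g M) = ind (image_mset g' s) M"
proof -
  have "image_mset g M = s \<longleftrightarrow> M = image_mset g' s"
    using assms by (auto simp: image_mset.compositionality o_def)
  then show ?thesis by (simp add: ind_def)
qed

lemma cobd_zero: "cobd (\<lambda>_. 0) M = 0"
  by (simp add: cobd_def)

text \<open>The simplices with \<open>s\<close> as a face arise by adding one new vertex. Adding a
  vertex of \<open>s\<close> again produces the face \<open>s\<close> twice and contributes nothing.\<close>

lemma cobd_ind:
  fixes s :: "'a::finite multiset"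
  assumes "\<And>a. count s a \<le> 1"
  shows "cobd (ind s) M = (\<Sum>a\<in>UNIV - set_mset s. ind (add_mset a s) M)"
proof (cases "\<exists>a. M = add_mset a s")
  case True
  then obtain a where M: "M = add_mset a s" by blast
  have *: "cobd (\<lambda>N. ind s' (add_mset a N)) N' = 0" if "a \<notin># s'" for s' N' :: "'a multiset"
  proof -
    have "(\<lambda>N. ind s' (add_mset a N)) = (\<lambda>_. 0)" using that by (auto simp: ind_def fun_eq_iff)
    then show ?thesis by (simp add: cobd_zero)
  qed
  show ?thesis
  proof (cases "a \<in># s")
    case False
    have "(\<Sum>b\<in>UNIV - set_mset s. ind (add_mset b s) M) =
          (\<Sum>b\<in>UNIV - set_mset s. if b = a then 1 else 0)"
      by (intro sum.cong) (auto simp: M ind_def)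
    then show ?thesis using False by (simp add: M cobd_add_mset *)
  next
    case True
    then obtain s' where s': "s = add_mset a s'" by (metis insert_DiffM)
    with assms[of a] have a: "a \<notin># s'" by (auto simp: count_eq_zero_iff)
    have "(\<lambda>N. ind s (add_mset a N)) = ind s'" by (simp add: s' ind_def fun_eq_iff)
    then have "cobd (ind s) M = 1 + cobd (ind s') s" by (simp add: M cobd_add_mset)
    also have "\<dots> = 0" using a by (simp add: s' cobd_add_mset *)
    finally show ?thesis using True
      by (auto simp: M ind_def intro!: sum.neutral)
  qed
next
  case False
  have "M - {#a#} \<noteq> s" if "a \<in># M" for a
    using that False by (metis insert_DiffM)
  then have "cobd (ind s) M = (\<Sum>a\<in>#M. 0)"
    unfolding cobd_def by (intro arg_cong[where f=sum_mset] image_mset_cong) (auto simp: ind_def)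
  moreover have "(\<Sum>a\<in>UNIV - set_mset s. ind (add_mset a s) M) = 0"
    using False by (intro sum.neutral) (auto simp: ind_def)
  ultimately show ?thesis by simp
qed

lemma cobd_ind_label:
  assumes "\<And>a. count s a \<le> 1"
  shows "cobd (ind s) M = (let f = \<lambda>a. if a \<in># s then 0 else ind (add_mset a s) M
    in f SP + f SN + f CP + f CN + f V0 + f V1 + f V2 + f V3)"
proof -
  have "cobd (ind s) M = (\<Sum>a\<in>UNIV. if a \<in># s then 0 else ind (add_mset a s) M)"
    unfolding cobd_ind[OF assms] by (intro sum.mono_neutral_cong_left) auto
  then show ?thesis by (simp add: UNIV_label Let_def add.assoc)
qed

lemma opposite_opposite [simp]: "opposite (opposite a) = a"
  by (cases a) simp_all

lemma opposite_neq [simp]: "opposite a \<noteq> a"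
  by (cases a) simp_all

lemma compatible_add_mset:
  "compatible (add_mset a M) \<longleftrightarrow> opposite a \<notin># M \<and> compatible M"
  unfolding compatible_def by (auto dest: arg_cong[of _ _ opposite])

lemma ind_incompatible: "compatible M \<Longrightarrow> \<not> compatible s \<Longrightarrow> ind s M = 0"
  by (auto simp: ind_def)

text \<open>All five cochains live on simplices through \<open>SP\<close>; they are cones over
  cochains of the link of \<open>SP\<close>, an octahedron. They are found from the bottom up. The coboundary of
  \<open>point_cochain\<close> is the sum of all edges from \<open>SP\<close>, which splits as
  \<open>edge_cochain\<close> plus its image under a turn. The coboundary of \<open>edge_cochain\<close> is
  the sum of \<open>turn_cochain\<close> over the four reflections, and so on; the free choices at each step are settled by the invariance
  properties \<open>swap_cochain_swap_label\<close> and \<open>sum_cochain_invariant\<close>.\<close>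

definition top_cochain :: "label multiset \<Rightarrow> bit" where
  "top_cochain M = ind {#SP, CN, V1, V2#} M + ind {#SP, CP, V2, V3#} M + ind {#SP, CN, V3, V0#} M"

definition turn_cochain :: "label multiset \<Rightarrow> bit" where
  "turn_cochain M = ind {#SP, V1, V2#} M + ind {#SP, CP, V1#} M"

definition swap_cochain :: "label multiset \<Rightarrow> bit" where
  "swap_cochain M = ind {#SP, CN, V0#} M + ind {#SP, CN, V2#} M + ind {#SP, CP, V3#} M"

definition edge_cochain :: "label multiset \<Rightarrow> bit" where
  "edge_cochain M = ind {#SP, CP#} M + ind {#SP, V0#} M + ind {#SP, V2#} M"

definition point_cochain :: "label multiset \<Rightarrow> bit" where
  "point_cochain M = ind {#SP#} M"

lemma turn_label_inverse: "turn_label (turn_label' a) = a" "turn_label' (turn_label a) = a"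
  by (cases a; simp)+

lemma swap_label_swap_label: "swap_label (swap_label a) = a"
  by (cases a) simp_all

lemmas ind_turn_label = ind_image_mset[of turn_label turn_label', OF turn_label_inverse]
lemmas ind_swap_label = ind_image_mset[of swap_label swap_label, OF swap_label_swap_label swap_label_swap_label]

lemma ind_turn_label':  "ind s (image_mset turn_label' M) = ind (image_mset turn_label s) M"
  by (rule ind_image_mset) (simp_all add: turn_label_inverse)

lemmas label_eval = cobd_plus cobd_ind_label ind_incompatible compatible_add_mset
  ind_turn_label ind_turn_label' ind_swap_label add_mset_commute ac_simps

lemma ind_replicate: "x \<in># s \<Longrightarrow> x \<noteq> y \<Longrightarrow> ind s (replicate_mset k y) = 0"
  by (auto simp: ind_def split: if_splits)

lemma cochains_replicate:
  "top_cochain (replicate_mset k SP) = 0" "turn_cochain (replicate_mset k SP) = 0"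
  "swap_cochain (replicate_mset k SP) = 0" "edge_cochain (replicate_mset k SP) = 0"
  unfolding top_cochain_def turn_cochain_def swap_cochain_def edge_cochain_def
  by (simp_all add: ind_replicate[of CN] ind_replicate[of CP] ind_replicate[of V1]
      ind_replicate[of V0] ind_replicate[of V2])

text \<open>There are no simplices of dimension four in the boundary of the cross-polytope.\<close>

lemma cobd_top_cochain:
  "compatible M \<Longrightarrow> cobd top_cochain M = 0"
  unfolding top_cochain_def[abs_def] cobd_plus by (simp add: label_eval)

lemma cobd_turn_cochain:
  "compatible M \<Longrightarrow> cobd turn_cochain M = top_cochain M + top_cochain (image_mset turn_label M)"
  unfolding turn_cochain_def[abs_def] top_cochain_def cobd_plus by (simp add: label_eval)

lemma cobd_swap_cochain:
  "compatible M \<Longrightarrow> cobd swap_cochain M = top_cochain M + top_cochain (image_mset swap_label M)"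
  unfolding swap_cochain_def[abs_def] top_cochain_def cobd_plus by (simp add: label_eval)

lemma swap_cochain_swap_label: "swap_cochain (image_mset swap_label M) = swap_cochain M"
  unfolding swap_cochain_def by (simp add: label_eval)

lemma sum_cochain_invariant:
  "turn_cochain (image_mset turn_label' (image_mset swap_label M)) +
    swap_cochain (image_mset turn_label' (image_mset swap_label M)) = turn_cochain M + swap_cochain M"
  unfolding turn_cochain_def swap_cochain_def by (simp add: label_eval del: image_mset.compositionality)

text \<open>The four summands are the translates of \<open>turn_cochain\<close> under the reflections
  in the dihedral group, in the form in which they arise from the edges of the second octagon.\<close>

lemma cobd_edge_cochain:
  "compatible M \<Longrightarrow> cobd edge_cochain M =
    turn_cochain (image_mset turn_label' (image_mset swap_label M)) +
    turn_cochain (image_mset turn_label' (image_mset turn_label' (image_mset swap_label M))) +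
    turn_cochain (image_mset turn_label' (image_mset turn_label' (image_mset turn_label' (image_mset swap_label M)))) +
    turn_cochain (image_mset turn_label' (image_mset turn_label' (image_mset turn_label' (image_mset turn_label' (image_mset swap_label M)))))"
  unfolding edge_cochain_def[abs_def] turn_cochain_def cobd_plus
  by (simp add: label_eval del: image_mset.compositionality)

lemma cobd_point_cochain:
  "compatible M \<Longrightarrow> cobd point_cochain M = edge_cochain M + edge_cochain (image_mset turn_label M)"
  unfolding point_cochain_def[abs_def] edge_cochain_def cobd_plus by (simp add: label_eval)

section \<open>Equivariant labellings of quaternion space\<close>

text \<open>With the quaternion \<open>z + z' j\<close> written as the pair \<open>(z, z')\<close>, \<open>turn\<close> is right
  multiplication by \<open>exp (i \<pi> / 4)\<close>, and \<open>swap\<close> right multiplication by \<open>j\<close>. Together they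
  generate the binary dihedral group of order 16, which acts freely on nonzero
  quaternions.\<close>

definition turn :: "complex \<times> complex \<Rightarrow> complex \<times> complex" where
  "turn w = (cis (pi / 4) * fst w, cis (- (pi / 4)) * snd w)"

definition turn' :: "complex \<times> complex \<Rightarrow> complex \<times> complex" where
  "turn' w = (cis (- (pi / 4)) * fst w, cis (pi / 4) * snd w)"

definition swap :: "complex \<times> complex \<Rightarrow> complex \<times> complex" where
  "swap w = (- snd w, fst w)"

lemma turn_turn' [simp]: "turn (turn' w) = w" "turn' (turn w) = w"
  by (simp_all add: turn_def turn'_def cis_mult flip: mult.assoc)

lemma swap_swap [simp]: "swap (swap w) = - w"
  by (cases w) (simp add: swap_def)

lemma linear_turn: "linear turn" "linear turn'" "linear swap"
  by (auto simp: turn_def turn'_def swap_def algebra_simps intro!: linearI)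

lemma norm_turn [simp]: "norm (turn w) = norm w" "norm (turn' w) = norm w" "norm (swap w) = norm w"
  by (cases w; simp add: turn_def turn'_def swap_def norm_Pair norm_mult add.commute)+

text \<open>The combinatorial data extracted from a map without zeros. On the ball of radius
  \<open>R\<close>, the number \<open>\<eta>\<close> bounds the mesh below which labels are
  compatible.\<close>

locale equivariant_labelling =
  fixes lab :: "complex \<times> complex \<Rightarrow> label" and R \<eta> :: real
  assumes R: "R > 0" and \<eta>: "\<eta> > 0"
    and lab_0: "lab 0 = SN"
    and lab_outer: "\<And>w. R / 4 \<le> norm w \<Longrightarrow> norm w \<le> R \<Longrightarrow> lab w = SP"
    and lab_turn: "\<And>w. norm w \<le> R \<Longrightarrow> lab (turn w) = turn_label (lab w)"
    and lab_swap: "\<And>w. norm w \<le> R \<Longrightarrow> lab (swap w) = swap_label (lab w)"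
    and lab_near: "\<And>v w. norm v \<le> R \<Longrightarrow> norm w \<le> R \<Longrightarrow> dist v w < \<eta> \<Longrightarrow> lab w \<noteq> opposite (lab v)"
begin

lemma lab_turn': "norm w \<le> R \<Longrightarrow> lab (turn' w) = turn_label' (lab w)"
  using lab_turn[of "turn' w"] turn_label_inverse(2)[of "lab (turn' w)"] by simp

lemma lab_minus: "norm w \<le> R \<Longrightarrow> lab (- w) = lab w"
  using lab_swap[of "swap w"] lab_swap[of w] by (simp add: swap_label_swap_label)

text \<open>Enough subdivisions to make any simplex with at most five vertices in the ball
  of radius \<open>R\<close> finer than \<open>\<eta>\<close>.\<close>

definition depth :: nat where
  "depth = (SOME n. (1 - 1 / real 5) ^ n * (2 * R) < \<eta>)"

lemma depth: "(1 - 1 / real 5) ^ depth * (2 * R) < \<eta>"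
proof -
  have "(\<lambda>n. (1 - 1 / real 5) ^ n * (2 * R)) \<longlonglongrightarrow> 0 * (2 * R)"
    by (intro tendsto_intros LIMSEQ_power_zero) auto
  then have "\<forall>\<^sub>F n in sequentially. (1 - 1 / real 5) ^ n * (2 * R) < \<eta>"
    using \<eta> by (intro order_tendstoD(2)) auto
  then have "\<exists>n. (1 - 1 / real 5) ^ n * (2 * R) < \<eta>"
    by (rule eventually_happens'[OF sequentially_bot])
  then show ?thesis unfolding depth_def by (rule someI_ex)
qed

text \<open>The value of a cochain of labels on a large simplex of points: subdivide, label,
  evaluate.\<close>

definition refined :: "(label multiset \<Rightarrow> bit) \<Rightarrow> (complex \<times> complex) multiset \<Rightarrow> bit" where
  "refined \<mu> = (subdiv ^^ depth) (\<lambda>N. \<mu> (image_mset lab N))"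

text \<open>All small simplices are compatibly labelled, so only the values of a label cochain on
  compatible multisets matter.\<close>

lemma refined_local:
  assumes "M \<noteq> {#}" "size M \<le> 5" and M: "set_mset M \<subseteq> cball 0 R"
    and eq: "\<And>N. size N = size M \<Longrightarrow> set_mset N \<subseteq> convex hull set_mset M \<Longrightarrow>
      set_mset N \<subseteq> cball 0 R \<Longrightarrow> compatible (image_mset lab N) \<Longrightarrow> f N = g N"
  shows "(subdiv ^^ depth) f M = (subdiv ^^ depth) g M"
proof (rule subdiv_pow_local[OF assms(1,2)])
  show "dist p q \<le> 2 * R" if "p \<in># M" "q \<in># M" for p q
  proof -
    have "norm p \<le> R" "norm q \<le> R"
      using that M by (metis mem_cball_0 subsetD)+
    then show ?thesis using norm_triangle_ineq4[of p q] by (simp add: dist_norm)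
  qed
  fix N assume N: "size N = size M" "set_mset N \<subseteq> convex hull set_mset M"
    "\<And>p q. p \<in># N \<Longrightarrow> q \<in># N \<Longrightarrow> dist p q \<le> (1 - 1 / real 5) ^ depth * (2 * R)"
  have "convex hull set_mset M \<subseteq> cball 0 R"
    using M by (intro hull_minimal) auto
  with N(2) have NR: "set_mset N \<subseteq> cball 0 R" by blast
  have "lab q \<noteq> opposite (lab p)" if "p \<in># N" "q \<in># N" for p q
  proof (rule lab_near)
    show "norm p \<le> R" "norm q \<le> R"
      using that NR by (metis mem_cball_0 subsetD)+
    show "dist p q < \<eta>" using N(3)[OF that] depth by linarith
  qed
  then have "compatible (image_mset lab N)"
    by (fastforce simp: compatible_def)
  then show "f N = g N" using N NR by (intro eq)
qed

lemma refined_cobd: "2 \<le> size M \<Longrightarrow> refined (cobd \<mu>) M = cobd (refined \<mu>) M"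
proof -
  have "(\<lambda>N. cobd \<mu> (image_mset lab N)) = cobd (\<lambda>N. \<mu> (image_mset lab N))"
    by (simp add: fun_eq_iff cobd_image_mset)
  moreover assume "2 \<le> size M"
  ultimately show ?thesis by (simp add: refined_def subdiv_pow_cobd)
qed

lemma refined_plus: "refined (\<lambda>M. \<mu> M + \<nu> M) M = refined \<mu> M + refined \<nu> M"
  by (simp add: refined_def subdiv_pow_plus)

lemma refined_singleton: "refined \<mu> {#v#} = \<mu> {#lab v#}"
  by (simp add: refined_def subdiv_pow_singleton)

lemma refined_cong:
  assumes "M \<noteq> {#}" "size M \<le> 5" "set_mset M \<subseteq> cball 0 R"
    and "\<And>M. compatible M \<Longrightarrow> \<mu> M = \<nu> M"
  shows "refined \<mu> M = refined \<nu> M"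
  unfolding refined_def using assms by (intro refined_local) auto

lemma refined_map:
  assumes "linear A" "\<And>w. norm w \<le> R \<Longrightarrow> lab (A w) = g (lab w)"
    and "M \<noteq> {#}" "size M \<le> 5" "set_mset M \<subseteq> cball 0 R"
  shows "refined \<mu> (image_mset A M) = refined (\<lambda>M. \<mu> (image_mset g M)) M"
  unfolding refined_def subdiv_pow_linear[OF assms(1)]
proof (rule refined_local[OF assms(3-5)])
  fix N :: "(complex \<times> complex) multiset"
  assume "set_mset N \<subseteq> cball 0 R"
  then have "image_mset lab (image_mset A N) = image_mset g (image_mset lab N)"
    using assms(2) by (auto simp: image_mset.compositionality subset_iff intro!: image_mset_cong)
  then show "\<mu> (image_mset lab (image_mset A N)) = \<mu> (image_mset g (image_mset lab N))" by simp
qed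

lemmas refined_turn = refined_map[OF linear_turn(1) lab_turn]
lemmas refined_turn' = refined_map[OF linear_turn(2) lab_turn']
lemmas refined_swap = refined_map[OF linear_turn(3) lab_swap]

lemma refined_minus:
  assumes "M \<noteq> {#}" "size M \<le> 5" "set_mset M \<subseteq> cball 0 R"
  shows "refined \<mu> (image_mset uminus M) = refined \<mu> M"
  using refined_map[of uminus id, OF _ _ assms] lab_minus by (simp add: linear_iff)

text \<open>The vertices of two regular octagons in the two complex coordinate lines. Their join
  triangulates the 3-sphere, and the group permutes its simplices freely: a turn moves one
  octagon forwards and the other one backwards, and \<open>swap\<close> exchanges them.\<close>

definition p :: "nat \<Rightarrow> complex \<times> complex" where
  "p i = (R * cis (real i * pi / 4), 0)"

definition q :: "nat \<Rightarrow> complex \<times> complex" where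
  "q j = (0, R * cis (real j * pi / 4))"

lemma norm_pq [simp]: "norm (p i) = R" "norm (q j) = R"
  using R by (simp_all add: p_def q_def norm_Pair norm_mult)

lemma cis_plus_pi: "cis (x + pi) = - cis x"
  by (simp add: flip: cis_mult)

lemma minus_pq [simp]: "- p i = p (i + 4)" "- q j = q (j + 4)"
  using cis_plus_pi[of "real i * pi / 4"] cis_plus_pi[of "real j * pi / 4"]
  by (simp_all add: p_def q_def field_simps)

lemma pq_8 [simp]: "p (8 + i) = p i" "q (8 + j) = q j"
proof -
  have "p (i + 4 + 4) = - (- p i)" "q (j + 4 + 4) = - (- q j)"
    by (simp_all only: minus_pq)
  then show "p (8 + i) = p i" "q (8 + j) = q j"
    by (simp_all only: minus_minus numeral_eq_Suc) (simp_all add: numeral_eq_Suc)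
qed

lemma pq_numeral [simp]: "p 8 = p 0" "q 8 = q 0" "p 9 = p (Suc 0)" "q 9 = q (Suc 0)"
  using pq_8[of 0] pq_8[of "Suc 0"] by simp_all

lemma turn_pq [simp]: "turn (p i) = p (Suc i)" "turn (q (Suc j)) = q j"
  "turn' (p (Suc i)) = p i" "turn' (q j) = q (Suc j)" "swap (p i) = q i" "swap (q j) = p (j + 4)"
proof -
  show "turn (p i) = p (Suc i)" "turn' (q j) = q (Suc j)" for i j
    by (simp_all add: turn_def turn'_def p_def q_def cis_mult field_simps)
  then show "turn (q (Suc j)) = q j" "turn' (p (Suc i)) = p i"
    by (metis turn_turn')+
  show "swap (p i) = q i" by (simp add: swap_def p_def q_def)
  show "swap (q j) = p (j + 4)"
    using minus_pq(1)[of j] by (simp add: swap_def p_def q_def)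
qed

lemma turn_0 [simp]: "turn 0 = 0" "turn' 0 = 0" "swap 0 = 0"
  by (simp_all add: turn_def turn'_def swap_def zero_prod_def)

text \<open>The linear functional that adds the components along \<open>p 0\<close> and \<open>q s\<close> is at least
  \<open>R / 2\<close> at all four vertices, and it has norm at most 2.\<close>

lemma outer_hull:
  assumes w: "w \<in> convex hull {p 0, p 1, q s, q (Suc s)}"
  shows "R / 4 \<le> norm w"
proof -
  define c where "c = cis (- (real s * pi / 4))"
  define g where "g = (\<lambda>w. Re (fst w) + Re (c * snd w))"
  have *: "{w. g w \<ge> R / 2} = g -` {R / 2..}" by auto
  have lin: "linear g"
    by (auto simp: g_def algebra_simps intro!: linearI)
  have "convex {w. g w \<ge> R / 2}"
    unfolding * by (rule convex_linear_vimage[OF lin]) simp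
  moreover have "c * cis (real s * pi / 4) = 1" "c * cis (real (Suc s) * pi / 4) = cis (pi / 4)"
    by (simp_all add: c_def cis_mult algebra_simps add_divide_distrib)
  then have "Re (c * (R * cis (real s * pi / 4))) = R"
    "Re (c * (R * cis (real (Suc s) * pi / 4))) = R * (sqrt 2 / 2)"
    by (simp_all only: mult.left_commute[of c]; simp add: cos_45)+
  moreover have "R / 2 \<le> R * (sqrt 2 / 2)"
    using R by simp
  ultimately have "convex hull {p 0, p 1, q s, q (Suc s)} \<subseteq> {w. g w \<ge> R / 2}"
    using R by (intro hull_minimal) (auto simp: g_def p_def q_def cos_45)
  with w have "R / 2 \<le> g w" by auto
  also have "\<dots> \<le> norm (fst w) + norm (c * snd w)"
    unfolding g_def by (intro add_mono complex_Re_le_cmod)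
  also have "\<dots> = norm (fst w) + norm (snd w)"
    by (simp add: c_def norm_mult)
  also have "\<dots> \<le> norm w + norm w"
    by (intro add_mono) (metis norm_fst_le prod.collapse, metis norm_snd_le prod.collapse)
  finally show ?thesis by simp
qed

text \<open>Outer simplices carry the label \<open>SP\<close> only, so cochains that vanish on constant
  multisets vanish there. This lets the outer face of every cone be ignored.\<close>

lemma refined_outer:
  assumes "set_mset M \<subseteq> {p 0, p 1, q s, q (Suc s)}" "M \<noteq> {#}" "size M \<le> 5"
    and "\<mu> (replicate_mset (size M) SP) = 0"
  shows "refined \<mu> M = 0"
proof -
  have "refined \<mu> M = (subdiv ^^ depth) (\<lambda>_. 0) M"
    unfolding refined_def
  proof (rule refined_local[OF assms(2,3)])
    show "set_mset M \<subseteq> cball 0 R"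
      using assms(1) by auto
    fix N assume N: "size N = size M" "set_mset N \<subseteq> convex hull set_mset M" "set_mset N \<subseteq> cball 0 R"
    have "lab w = SP" if "w \<in># N" for w
    proof -
      have "w \<in> convex hull {p 0, p 1, q s, q (Suc s)}"
        using that N(2) hull_mono[OF assms(1), of convex] by blast
      moreover have "norm w \<le> R" using that N(3) by (metis mem_cball_0 subsetD)
      ultimately show ?thesis by (intro lab_outer outer_hull[of _ s])
    qed
    then have "image_mset lab N = image_mset (\<lambda>_. SP) N"
      by (intro image_mset_cong) auto
    then show "\<mu> (image_mset lab N) = 0"
      using assms(4) N(1) by (simp add: image_mset_const_eq)
  qed
  then show ?thesis by (simp add: subdiv_pow_zero)
qed

end

context equivariant_labelling
begin

lemma R_nonneg [simp]: "0 \<le> R" using R by simp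

text \<open>Cones from the origin over the cells of the join: over triangles (\<open>u\<close>), over edges
  between the octagons (\<open>d\<close>), over edges of the second octagon (\<open>v\<close>) and over one edge of
  the first octagon (\<open>e\<close>). Up to the group action, these are all the triangles and edges that occur.\<close>

definition u :: "nat \<Rightarrow> (complex \<times> complex) multiset" where
  "u s = {#0, p 0, q s, q (Suc s)#}"

definition d :: "nat \<Rightarrow> (complex \<times> complex) multiset" where
  "d s = {#0, p 0, q s#}"

definition v :: "nat \<Rightarrow> (complex \<times> complex) multiset" where
  "v s = {#0, q s, q (Suc s)#}"

definition e :: "(complex \<times> complex) multiset" where
  "e = {#0, p 0, p 1#}"

lemma top_cochain_outer: "refined top_cochain {#p 0, p 1, q s, q (Suc s)#} = 0"
  by (rule refined_outer[of _ s]) (use cochains_replicate(1)[of 4] in \<open>auto simp: numeral_eq_Suc\<close>)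

text \<open>The tetrahedra \<open>p 0, p 1, q s, q (Suc s)\<close> for \<open>s < 4\<close> represent the four orbits,
  so their cones form a fundamental domain for the group. The right-hand sides telescope when these
  relations are added.\<close>

lemma tetrahedra_relation:
  "refined top_cochain (u s) + refined top_cochain (image_mset turn (u (Suc s))) =
   refined top_cochain {#0, p 0, p 1, q s#} + refined top_cochain {#0, p 0, p 1, q (Suc s)#}"
proof -
  let ?T = "{#0, p 0, p 1, q s, q (Suc s)#}"
  have "cobd (refined top_cochain) ?T = refined (cobd top_cochain) ?T"
    by (simp add: refined_cobd)
  also have "\<dots> = refined (\<lambda>_. 0) ?T"
    by (rule refined_cong) (auto simp: cobd_top_cochain)
  also have "\<dots> = 0"
    by (simp add: refined_def subdiv_pow_zero)
  finally have "cobd (refined top_cochain) ?T = 0" .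
  then show ?thesis
    using top_cochain_outer[of s]
    by (simp add: cobd_add_mset u_def add_mset_commute ac_simps bit_add_eq_0_iff)
qed

text \<open>The two faces that survive the telescoping are identified with cones \<open>u\<close> by \<open>swap\<close>
  and the antipodal map.\<close>

lemma side_faces:
  "refined top_cochain {#0, p 0, p 1, q 4#} = refined (\<lambda>M. top_cochain (image_mset swap_label M)) (u 0)"
  "refined top_cochain {#0, p 0, p 1, q 0#} = refined (\<lambda>M. top_cochain (image_mset swap_label M)) (u 4)"
proof -
  have a: "image_mset swap {#0, p 0, p 1, q 4#} = u 0"
    by (simp add: u_def add_mset_commute)
  have b: "image_mset swap {#0, p 0, p 1, q 0#} = image_mset uminus (u 4)"
    by (simp add: u_def add_mset_commute)
  have *: "refined top_cochain M = refined (\<lambda>M. top_cochain (image_mset swap_label M)) (image_mset swap M)"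
    if "M \<noteq> {#}" "size M \<le> 5" "set_mset M \<subseteq> cball 0 R" for M
    using that by (simp add: refined_swap image_mset.compositionality o_def swap_label_swap_label)
  show "refined top_cochain {#0, p 0, p 1, q 4#} = refined (\<lambda>M. top_cochain (image_mset swap_label M)) (u 0)"
    unfolding a[symmetric] by (rule *) auto
  have "refined top_cochain {#0, p 0, p 1, q 0#} = refined (\<lambda>M. top_cochain (image_mset swap_label M)) (image_mset uminus (u 4))"
    unfolding b[symmetric] by (rule *) auto
  also have "\<dots> = refined (\<lambda>M. top_cochain (image_mset swap_label M)) (u 4)"
    by (rule refined_minus) (auto simp: u_def)
  finally show "refined top_cochain {#0, p 0, p 1, q 0#} = refined (\<lambda>M. top_cochain (image_mset swap_label M)) (u 4)" .
qed

lemma refined_cobd_cong: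
  assumes "\<And>M. compatible M \<Longrightarrow> cobd \<mu> M = \<nu> M"
    and "2 \<le> size M" "size M \<le> 5" "set_mset M \<subseteq> cball 0 R"
  shows "cobd (refined \<mu>) M = refined \<nu> M"
proof -
  have "cobd (refined \<mu>) M = refined (cobd \<mu>) M" using assms by (simp add: refined_cobd)
  also have "\<dots> = refined \<nu> M" using assms by (intro refined_cong) auto
  finally show ?thesis .
qed

lemma cobd_turn_cochain_u: "cobd (refined turn_cochain) (u s) = refined top_cochain (u s) + refined top_cochain (image_mset turn (u s))"
  using refined_cobd_cong[OF cobd_turn_cochain, of "u s"] refined_turn[of "u s" top_cochain] by (auto simp: refined_plus u_def)

lemma cobd_swap_cochain_u: "cobd (refined swap_cochain) (u s) = refined top_cochain (u s) + refined (\<lambda>M. top_cochain (image_mset swap_label M)) (u s)"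
  using refined_cobd_cong[OF cobd_swap_cochain, of "u s"] by (auto simp: refined_plus u_def)

text \<open>The sum of the four relations between tetrahedra. Each translate is paired with its original,
  and each pair is a coboundary on the label side, so the total drops by one dimension.\<close>

lemma triangles_relation:
  "cobd (refined turn_cochain) (u 1) + cobd (refined turn_cochain) (u 2) + cobd (refined turn_cochain) (u 3) + cobd (refined turn_cochain) (u 4) +
   cobd (refined swap_cochain) (u 0) + cobd (refined swap_cochain) (u 4) = 0"
proof -
  have *: "refined top_cochain (u s) + refined top_cochain (image_mset turn (u (Suc s))) +
   (refined top_cochain {#0, p 0, p 1, q s#} + refined top_cochain {#0, p 0, p 1, q (Suc s)#}) = 0" for s
    using tetrahedra_relation by (simp add: bit_add_eq_0_iff)
  show ?thesis
    using side_faces arg_cong2[OF arg_cong2[OF *[of 0] *[of 1], of "(+)"] arg_cong2[OF *[of 2] *[of 3], of "(+)"], of "(+)"]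
    unfolding cobd_turn_cochain_u cobd_swap_cochain_u
    by (simp add: numeral_eq_Suc ac_simps)
qed

lemma cobd_u:
  assumes "\<mu> (replicate_mset 3 SP) = 0"
  shows "cobd (refined \<mu>) (u s) = refined \<mu> (v s) + refined \<mu> (d s) + refined \<mu> (d (Suc s))"
proof -
  have "refined \<mu> {#p 0, q s, q (Suc s)#} = 0"
    by (rule refined_outer[of _ s]) (use assms in \<open>auto simp: numeral_eq_Suc\<close>)
  then show ?thesis
    by (simp add: cobd_add_mset u_def v_def d_def ac_simps)
qed

lemma d_4: "refined swap_cochain (d 4) = refined swap_cochain (d 0)"
proof -
  have "d 4 = image_mset uminus (image_mset swap (d 0))"
    by (simp add: d_def add_mset_commute)
  then have "refined swap_cochain (d 4) = refined swap_cochain (image_mset swap (d 0))"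
    using refined_minus[of "image_mset swap (d 0)" swap_cochain] by (simp add: d_def add_mset_commute)
  also have "\<dots> = refined swap_cochain (d 0)"
    by (subst refined_swap) (auto simp: d_def swap_cochain_swap_label)
  finally show ?thesis .
qed

text \<open>The edge from \<open>p 0\<close> to \<open>q 5\<close> is the image of the edge from \<open>p 0\<close> to \<open>q 1\<close>
  under \<open>swap\<close>, the antipodal map and a backward turn.\<close>

lemma d_5: "refined \<mu> (d 5) = refined (\<lambda>M. \<mu> (image_mset turn_label' (image_mset swap_label M))) (d 1)"
proof -
  have "d 5 = image_mset turn' (image_mset uminus (image_mset swap (d 1)))"
    by (simp add: d_def add_mset_commute)
  then have "refined \<mu> (d 5) = refined (\<lambda>M. \<mu> (image_mset turn_label' M)) (image_mset uminus (image_mset swap (d 1)))"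
    by (subst refined_turn'[symmetric]) (auto simp: d_def add_mset_commute)
  also have "\<dots> = refined (\<lambda>M. \<mu> (image_mset turn_label' M)) (image_mset swap (d 1))"
    by (rule refined_minus) (auto simp: d_def)
  also have "\<dots> = refined (\<lambda>M. \<mu> (image_mset turn_label' (image_mset swap_label M))) (d 1)"
    by (rule refined_swap) (auto simp: d_def)
  finally show ?thesis .
qed

lemma d_5_sum: "refined turn_cochain (d 5) + refined swap_cochain (d 5) = refined turn_cochain (d 1) + refined swap_cochain (d 1)"
  unfolding d_5 by (simp add: sum_cochain_invariant flip: refined_plus)

lemma v_4: "refined \<mu> (v 4) = refined \<mu> (v 0)"
  using refined_minus[of "v 0" \<mu>] by (simp add: v_def)

text \<open>In the sum of the coboundaries, the cones \<open>d\<close> that do not telescope cancel in pairs by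
  the two invariance properties, and only the cones over four consecutive edges of the second
  octagon remain.\<close>

lemma fan_relation: "refined turn_cochain (v 1) + refined turn_cochain (v 2) + refined turn_cochain (v 3) + refined turn_cochain (v 4) = 0"
proof -
  have "refined turn_cochain (v 1) + refined turn_cochain (v 2) + refined turn_cochain (v 3) + refined turn_cochain (v 4) +
      ((refined turn_cochain (d 5) + refined swap_cochain (d 5)) + (refined turn_cochain (d 1) + refined swap_cochain (d 1)) +
      (refined swap_cochain (v 4) + refined swap_cochain (v 0)) + (refined swap_cochain (d 4) + refined swap_cochain (d 0))) = 0"
    using triangles_relation by (simp add: cobd_u cochains_replicate) (simp add: numeral_eq_Suc ac_simps)
  then show ?thesis by (simp only: d_5_sum v_4 d_4 bit_add_self add_0_right)
qed

text \<open>Every edge of either octagon is a translate of one edge; summing over the four in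
  \<open>fan_relation\<close> therefore produces the sum in \<open>cobd_edge_cochain\<close>.\<close>

lemma v_e:
  "refined \<mu> (v 0) = refined (\<lambda>M. \<mu> (image_mset swap_label M)) e"
  "refined \<mu> (v (Suc s)) = refined (\<lambda>M. \<mu> (image_mset turn_label' M)) (v s)"
proof -
  have "v 0 = image_mset swap e" "v (Suc s) = image_mset turn' (v s)"
    by (simp_all add: e_def v_def)
  then show "refined \<mu> (v 0) = refined (\<lambda>M. \<mu> (image_mset swap_label M)) e"
    "refined \<mu> (v (Suc s)) = refined (\<lambda>M. \<mu> (image_mset turn_label' M)) (v s)"
    by (simp_all only:) (rule refined_swap refined_turn'; auto simp: e_def v_def)+
qed

lemma contradiction: False
proof -
  have "cobd (refined edge_cochain) e = refined turn_cochain (v 1) + refined turn_cochain (v 2) + refined turn_cochain (v 3) + refined turn_cochain (v 4)"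
    using refined_cobd_cong[OF cobd_edge_cochain, of e]
    by (auto simp: refined_plus v_e numeral_eq_Suc e_def)
  then have "cobd (refined edge_cochain) e = 0" by (simp only: fan_relation)
  moreover have "refined edge_cochain {#p 0, p 1#} = 0"
    by (rule refined_outer[of _ 0]) (use cochains_replicate(4)[of 2] in \<open>auto simp: numeral_eq_Suc\<close>)
  ultimately have "refined edge_cochain {#0, p 0#} + refined edge_cochain (image_mset turn {#0, p 0#}) = 0"
    by (simp add: e_def cobd_add_mset ac_simps)
  moreover have "refined edge_cochain (image_mset turn {#0, p 0#}) = refined (\<lambda>M. edge_cochain (image_mset turn_label M)) {#0, p 0#}"
    by (rule refined_turn) auto
  moreover have "cobd (refined point_cochain) {#0, p 0#} =
      refined edge_cochain {#0, p 0#} + refined (\<lambda>M. edge_cochain (image_mset turn_label M)) {#0, p 0#}"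
    using refined_cobd_cong[OF cobd_point_cochain, of "{#0, p 0#}"] by (auto simp: refined_plus)
  ultimately have "refined point_cochain {#0#} + refined point_cochain {#p 0#} = 0"
    by (simp add: cobd_add_mset ac_simps)
  moreover have "lab (p 0) = SP"
    using R by (intro lab_outer) auto
  ultimately show False
    by (simp add: refined_singleton lab_0 point_cochain_def ind_def)
qed

end

section \<open>Boxes parametrised by quaternions\<close>

text \<open>The pure quaternion \<open>w (h i + \<zeta> j) w\<^sup>*\<close> in coordinates. For
  \<open>\<zeta>\<^sup>4 = 1\<close> the points \<open>\<plusminus>(h i + \<zeta> j)\<close> are the vertices of a
  square based box of height \<open>2 h\<close> whose base has diagonals of length 2.\<close>

definition box_vertex :: "complex \<times> complex \<Rightarrow> real \<Rightarrow> complex \<Rightarrow> real^3" where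
  "box_vertex w h \<zeta> = (let a = fst w; b = snd w; c = a * a * \<zeta> + b * b * cnj \<zeta> - 2 * \<i> * of_real h * a * b in
     vector [h * ((norm a)\<^sup>2 - (norm b)\<^sup>2) + 2 * Im (a * cnj b * \<zeta>), Re c, Im c])"

lemma box_vertex_turn: "box_vertex (turn w) h \<zeta> = box_vertex w h (\<i> * \<zeta>)"
proof -
  obtain a b where w: "w = (a, b)" by fastforce
  define \<alpha> \<beta> where "\<alpha> = cis (pi / 4)" and "\<beta> = cis (- (pi / 4))"
  have c: "\<alpha> * \<alpha> = \<i>" "\<beta> * \<beta> = - \<i>" "\<alpha> * \<beta> = 1" "cnj \<beta> = \<alpha>"
    by (simp_all add: \<alpha>_def \<beta>_def cis_mult cis_cnj)
  have "(\<alpha> * a) * (\<alpha> * a) * \<zeta> + (\<beta> * b) * (\<beta> * b) * cnj \<zeta> - 2 * \<i> * of_real h * (\<alpha> * a) * (\<beta> * b)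
      = (\<alpha> * \<alpha>) * (a * a * \<zeta>) + (\<beta> * \<beta>) * (b * b * cnj \<zeta>) - (\<alpha> * \<beta>) * (2 * \<i> * of_real h * a * b)"
    by (simp only: mult_ac)
  also have "\<dots> = a * a * (\<i> * \<zeta>) + b * b * cnj (\<i> * \<zeta>) - 2 * \<i> * of_real h * a * b"
    by (simp add: c)
  finally have 1: "(\<alpha> * a) * (\<alpha> * a) * \<zeta> + (\<beta> * b) * (\<beta> * b) * cnj \<zeta> - 2 * \<i> * of_real h * (\<alpha> * a) * (\<beta> * b)
      = a * a * (\<i> * \<zeta>) + b * b * cnj (\<i> * \<zeta>) - 2 * \<i> * of_real h * a * b" .
  have "(\<alpha> * a) * cnj (\<beta> * b) * \<zeta> = (\<alpha> * \<alpha>) * (a * cnj b * \<zeta>)"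
    by (simp add: c mult_ac)
  also have "\<dots> = a * cnj b * (\<i> * \<zeta>)"
    unfolding c by (simp only: mult_ac)
  finally have 2: "(\<alpha> * a) * cnj (\<beta> * b) * \<zeta> = a * cnj b * (\<i> * \<zeta>)" .
  have 3: "norm (\<alpha> * a) = norm a" "norm (\<beta> * b) = norm b"
    by (simp_all add: \<alpha>_def \<beta>_def norm_mult)
  show ?thesis
    unfolding box_vertex_def turn_def w Let_def fst_conv snd_conv \<alpha>_def[symmetric] \<beta>_def[symmetric] 1 2 3 ..
qed

text \<open>Conjugation by \<open>j\<close> sends \<open>h i + \<zeta> j\<close> to minus
  \<open>h i - \<zeta>\<^sup>* j\<close>; the sign is harmless, since vertices only matter up to sign.\<close>

lemma box_vertex_swap: "box_vertex (swap w) h \<zeta> = - box_vertex w h (- cnj \<zeta>)"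
proof -
  have "Im (- b * cnj a * \<zeta>) = Im (a * cnj b * cnj \<zeta>)" for a b
    by (simp add: algebra_simps)
  then show ?thesis
    unfolding box_vertex_def swap_def Let_def
    by (simp add: vec_eq_iff forall_3 algebra_simps)
qed

text \<open>For fixed \<open>w\<close> the map is a similarity with factor \<open>|w|\<^sup>2\<close>.\<close>

lemma inner_box_vertex: "box_vertex w h \<zeta> \<bullet> box_vertex w k \<xi> = norm w ^ 4 * (h * k + Re (\<zeta> * cnj \<xi>))"
proof -
  obtain a b c d where w: "w = (Complex a b, Complex c d)" by (metis surj_pair complex_surj)
  obtain x y x' y' where z: "\<zeta> = Complex x y" "\<xi> = Complex x' y'" by (metis complex_surj)
  have n: "norm w ^ 4 = (a\<^sup>2 + b\<^sup>2 + (c\<^sup>2 + d\<^sup>2))\<^sup>2"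
  proof -
    have "(norm w)\<^sup>2 = a\<^sup>2 + b\<^sup>2 + (c\<^sup>2 + d\<^sup>2)"
      by (simp add: w norm_Pair cmod_power2)
    then show ?thesis by (metis power2_eq_square power4_eq_xxxx mult.assoc)
  qed
  show ?thesis
    unfolding n
    by (simp add: w z box_vertex_def Let_def inner_vec_def sum_3 cmod_power2)
       (simp add: power2_eq_square algebra_simps)
qed

lemma norm_box_vertex: "norm (box_vertex w h \<zeta>) = (norm w)\<^sup>2 * sqrt (h\<^sup>2 + (norm \<zeta>)\<^sup>2)"
proof -
  have "(norm (box_vertex w h \<zeta>))\<^sup>2 = ((norm w)\<^sup>2 * sqrt (h\<^sup>2 + (norm \<zeta>)\<^sup>2))\<^sup>2"
    unfolding power2_norm_eq_inner[of "box_vertex w h \<zeta>"] inner_box_vertex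
    by (simp add: power_mult_distrib complex_mult_cnj cmod_power2) (simp add: power2_eq_square)
  then show ?thesis by (simp add: power2_eq_iff_nonneg)
qed

lemma box_vertex_add: "box_vertex w (h + h') (\<zeta> + \<zeta>') = box_vertex w h \<zeta> + box_vertex w h' \<zeta>'"
  by (simp add: box_vertex_def Let_def vec_eq_iff forall_3 algebra_simps)

lemma box_vertex_scale: "box_vertex w (r * h) (of_real r * \<zeta>) = r *\<^sub>R box_vertex w h \<zeta>"
  by (simp add: box_vertex_def Let_def vec_eq_iff forall_3 algebra_simps)

lemma continuous_on_box_vertex: "continuous_on A (\<lambda>w. box_vertex w h \<zeta>)"
proof -
  have "continuous_on A (\<lambda>w. box_vertex w h \<zeta> $ i)" for i :: 3
    using exhaust_3[of i]
    by (elim disjE; simp only: box_vertex_def Let_def vector_3; intro continuous_intros)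
  then have "continuous_on A (\<lambda>w. \<chi> i. box_vertex w h \<zeta> $ i)"
    by (rule continuous_on_vec_lambda)
  then show ?thesis by (simp add: vec_nth_inverse)
qed

section \<open>Even functions and boxes\<close>

definition fourth_roots :: "complex set" where
  "fourth_roots = {1, \<i>, -1, -\<i>}"

lemma fourth_roots_minus: "\<zeta> \<in> fourth_roots \<Longrightarrow> - \<zeta> \<in> fourth_roots"
  by (auto simp: fourth_roots_def)

text \<open>A square based box has four different diagonals: two of its half-diagonals
  are neither equal nor opposite, because their inner product is proportional to
  \<open>h\<^sup>2 + Re (\<zeta> \<xi>\<^sup>*)\<close>, which is smaller in absolute value than
  \<open>h\<^sup>2 + 1\<close>.\<close>

lemma box_vertex_inj:
  assumes "h > 0" "w \<noteq> 0" "\<zeta> \<in> fourth_roots" "\<xi> \<in> fourth_roots"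
    and "box_vertex w h \<zeta> = box_vertex w h \<xi> \<or> box_vertex w h \<zeta> = - box_vertex w h \<xi>"
  shows "\<zeta> = \<xi>"
proof (rule ccontr)
  assume "\<zeta> \<noteq> \<xi>"
  have n: "norm w ^ 4 > 0" using assms(2) by simp
  have "\<bar>box_vertex w h \<zeta> \<bullet> box_vertex w h \<xi>\<bar> = box_vertex w h \<xi> \<bullet> box_vertex w h \<xi>"
    using assms(5) by (elim disjE) (simp_all add: abs_of_nonneg[OF inner_ge_zero])
  then have "\<bar>h * h + Re (\<zeta> * cnj \<xi>)\<bar> = h * h + Re (\<xi> * cnj \<xi>)"
    using n unfolding inner_box_vertex by (simp add: abs_mult)
  moreover have "Re (\<xi> * cnj \<xi>) = 1" "Re (\<zeta> * cnj \<xi>) = 0 \<or> Re (\<zeta> * cnj \<xi>) = -1"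
    using assms(3,4) \<open>\<zeta> \<noteq> \<xi>\<close> by (auto simp: fourth_roots_def)
  moreover have "h * h > 0" using assms(1) by simp
  ultimately show False by auto
qed

definition vlabel :: "complex \<Rightarrow> label" where
  "vlabel \<zeta> = (if \<zeta> = 1 then V0 else if \<zeta> = \<i> then V1 else if \<zeta> = -1 then V2 else V3)"

lemma vlabel_eqs [simp]: "vlabel 1 = V0" "vlabel \<i> = V1" "vlabel (-1) = V2" "vlabel (-\<i>) = V3"
  by (auto simp: vlabel_def complex_eq_iff)

lemma vlabel_turn: "\<zeta> \<in> fourth_roots \<Longrightarrow> vlabel \<zeta> = turn_label (vlabel (\<i> * \<zeta>))"
  by (auto simp: fourth_roots_def)

lemma vlabel_swap: "\<zeta> \<in> fourth_roots \<Longrightarrow> vlabel \<zeta> = swap_label (vlabel (- cnj \<zeta>))"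
  by (auto simp: fourth_roots_def)

lemma vlabel_opposite: "\<zeta> \<in> fourth_roots \<Longrightarrow> \<xi> \<in> fourth_roots \<Longrightarrow> vlabel \<xi> = opposite (vlabel \<zeta>) \<Longrightarrow> \<xi> = - \<zeta>"
  by (auto simp: fourth_roots_def)

lemma vlabel_neq [simp]: "vlabel \<zeta> \<noteq> SP" "vlabel \<zeta> \<noteq> SN" "vlabel \<zeta> \<noteq> CP" "vlabel \<zeta> \<noteq> CN"
  by (auto simp: vlabel_def)

lemma opposite_vlabel [simp]:
  "opposite (vlabel \<zeta>) \<noteq> SP" "opposite (vlabel \<zeta>) \<noteq> SN" "opposite (vlabel \<zeta>) \<noteq> CP" "opposite (vlabel \<zeta>) \<noteq> CN"
  by (auto simp: vlabel_def)

text \<open>The quantitative form of the assumption that \<open>\<phi>\<close> vanishes on no box. The numbers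
  \<open>s w\<close>, \<open>c w\<close> and the two differences determine the values at the vertices of the box, so at
  least one of them must be large (\<open>unbalanced\<close>).\<close>

locale no_balanced_box =
  fixes \<phi> :: "real^3 \<Rightarrow> real" and h \<delta> R \<eta> :: real
  fixes \<psi> :: "complex \<Rightarrow> complex \<times> complex \<Rightarrow> real"
    and s c :: "complex \<times> complex \<Rightarrow> real"
  assumes \<psi>_def: "\<psi> = (\<lambda>\<zeta> w. \<phi> (box_vertex w h \<zeta>))"
    and s_def: "s = (\<lambda>w. \<psi> 1 w + \<psi> \<i> w + \<psi> (-1) w + \<psi> (-\<i>) w)"
    and c_def: "c = (\<lambda>w. \<psi> 1 w - \<psi> \<i> w + \<psi> (-1) w - \<psi> (-\<i>) w)"
    and h: "h > 0" and \<delta>: "\<delta> > 0" and R: "R > 0" and \<eta>: "\<eta> > 0"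
    and even: "\<And>x. \<phi> (- x) = \<phi> x"
    and centre: "s 0 \<le> - \<delta>"
    and outer: "\<And>w. R / 4 \<le> norm w \<Longrightarrow> norm w \<le> R \<Longrightarrow> \<delta> \<le> s w"
    and unbalanced: "\<And>w. norm w \<le> R \<Longrightarrow>
      \<delta> \<le> \<bar>s w\<bar> \<or> \<delta> \<le> \<bar>c w\<bar> \<or> (\<exists>\<zeta>\<in>fourth_roots. \<delta> \<le> \<psi> \<zeta> w - \<psi> (-\<zeta>) w)"
    and near: "\<And>v w. norm v \<le> R \<Longrightarrow> norm w \<le> R \<Longrightarrow> dist v w < \<eta> \<Longrightarrow>
      \<bar>s v - s w\<bar> < \<delta> \<and> \<bar>c v - c w\<bar> < \<delta> \<and> (\<forall>\<zeta>\<in>fourth_roots. \<bar>\<psi> \<zeta> v - \<psi> \<zeta> w\<bar> < \<delta>)"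
begin

text \<open>If \<open>s\<close> and \<open>c\<close> are small, several directions may qualify, and one
  of them has to be chosen equivariantly. The choice is made among
  the vertices of the box, a set of points of space that is the same for all parameters \<open>w\<close> in an
  orbit of the group; translating the chosen point back to a root of unity
  makes the label equivariant.\<close>

definition candidates :: "complex \<times> complex \<Rightarrow> (real^3) set" where
  "candidates w = {x. \<exists>\<zeta>\<in>fourth_roots. (x = box_vertex w h \<zeta> \<or> x = - box_vertex w h \<zeta>) \<and> \<delta> \<le> \<psi> \<zeta> w - \<psi> (-\<zeta>) w}"

definition choice :: "complex \<times> complex \<Rightarrow> real^3" where
  "choice w = (SOME x. x \<in> candidates w)"

definition direction :: "complex \<times> complex \<Rightarrow> complex" where
  "direction w = (SOME \<zeta>. \<zeta> \<in> fourth_roots \<and> (choice w = box_vertex w h \<zeta> \<or> choice w = - box_vertex w h \<zeta>))"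

lemma direction_eqI:
  assumes "w \<noteq> 0" "\<zeta> \<in> fourth_roots" "choice w = box_vertex w h \<zeta> \<or> choice w = - box_vertex w h \<zeta>"
  shows "direction w = \<zeta>"
proof -
  have d: "direction w \<in> fourth_roots \<and> (choice w = box_vertex w h (direction w) \<or> choice w = - box_vertex w h (direction w))"
    unfolding direction_def by (rule someI_ex) (use assms(2,3) in blast)
  show ?thesis
    by (rule box_vertex_inj[OF h assms(1) _ assms(2)]) (use d assms(3) in \<open>metis minus_minus\<close>)+
qed

lemma direction:
  assumes "w \<noteq> 0" "candidates w \<noteq> {}"
  shows "direction w \<in> fourth_roots" "choice w = box_vertex w h (direction w) \<or> choice w = - box_vertex w h (direction w)"
    "\<delta> \<le> \<psi> (direction w) w - \<psi> (- direction w) w"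
proof -
  have "choice w \<in> candidates w"
    unfolding choice_def using assms(2) by (simp add: some_in_eq)
  then obtain \<zeta> where z: "\<zeta> \<in> fourth_roots" "choice w = box_vertex w h \<zeta> \<or> choice w = - box_vertex w h \<zeta>"
    "\<delta> \<le> \<psi> \<zeta> w - \<psi> (-\<zeta>) w"
    by (auto simp: candidates_def)
  moreover have "direction w = \<zeta>"
    using assms(1) z by (intro direction_eqI)
  ultimately show "direction w \<in> fourth_roots" "choice w = box_vertex w h (direction w) \<or> choice w = - box_vertex w h (direction w)"
    "\<delta> \<le> \<psi> (direction w) w - \<psi> (- direction w) w" by simp_all
qed

text \<open>Parameters in the same orbit have the same candidates, hence the same chosen
  point, which they merely index differently.\<close>

lemma direction_equivariant:
  assumes vertex: "\<And>\<zeta>. box_vertex (A w) h \<zeta> = box_vertex w h (\<sigma> \<zeta>) \<or> box_vertex (A w) h \<zeta> = - box_vertex w h (\<sigma> \<zeta>)"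
    and \<sigma>: "bij_betw \<sigma> fourth_roots fourth_roots" "\<And>\<zeta>. \<sigma> (- \<zeta>) = - \<sigma> \<zeta>"
    and w: "w \<noteq> 0" "A w \<noteq> 0" "candidates w \<noteq> {}"
  shows "direction w = \<sigma> (direction (A w))" "direction (A w) \<in> fourth_roots"
proof -
  have \<psi>: "\<psi> \<zeta> (A w) = \<psi> (\<sigma> \<zeta>) w" for \<zeta>
    using vertex[of \<zeta>] even by (auto simp: \<psi>_def)
  have \<sigma>q: "\<sigma> \<zeta> \<in> fourth_roots" if "\<zeta> \<in> fourth_roots" for \<zeta>
    using \<sigma>(1) that by (auto simp: bij_betw_def)
  have "candidates (A w) = candidates w"
  proof (intro set_eqI iffI)
    fix x assume "x \<in> candidates (A w)"
    then obtain \<zeta> where "\<zeta> \<in> fourth_roots" "x = box_vertex (A w) h \<zeta> \<or> x = - box_vertex (A w) h \<zeta>"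
      "\<delta> \<le> \<psi> \<zeta> (A w) - \<psi> (-\<zeta>) (A w)"
      by (auto simp: candidates_def)
    then show "x \<in> candidates w"
      using vertex[of \<zeta>] \<sigma>q unfolding candidates_def \<psi> \<sigma>(2) by auto
  next
    fix x assume "x \<in> candidates w"
    then obtain \<xi> where x: "\<xi> \<in> fourth_roots" "x = box_vertex w h \<xi> \<or> x = - box_vertex w h \<xi>"
      "\<delta> \<le> \<psi> \<xi> w - \<psi> (-\<xi>) w"
      by (auto simp: candidates_def)
    obtain \<zeta> where "\<zeta> \<in> fourth_roots" "\<xi> = \<sigma> \<zeta>"
      using \<sigma>(1) x(1) by (auto simp: bij_betw_def)
    then show "x \<in> candidates (A w)"
      using vertex[of \<zeta>] x unfolding candidates_def
      by (intro CollectI bexI[of _ \<zeta>]) (auto simp: \<psi> \<sigma>(2))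
  qed
  then have ch: "choice (A w) = choice w" and ne: "candidates (A w) \<noteq> {}"
    using w by (simp_all add: choice_def)
  note d = direction[OF w(2) ne]
  show "direction (A w) \<in> fourth_roots" by (rule d)
  show "direction w = \<sigma> (direction (A w))"
    using d(2) vertex[of "direction (A w)"] by (intro direction_eqI w(1) \<sigma>q d(1)) (auto simp: ch)
qed

definition lab :: "complex \<times> complex \<Rightarrow> label" where
  "lab w = (if \<delta> \<le> s w then SP else if s w \<le> - \<delta> then SN
     else if \<delta> \<le> c w then CP else if c w \<le> - \<delta> then CN else vlabel (direction w))"

lemma candidates_nonempty:
  assumes "norm w \<le> R" "\<bar>s w\<bar> < \<delta>" "\<bar>c w\<bar> < \<delta>"
  shows "w \<noteq> 0" "candidates w \<noteq> {}"
proof -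
  show "w \<noteq> 0" using assms centre by auto
  obtain \<zeta> where "\<zeta> \<in> fourth_roots" "\<delta> \<le> \<psi> \<zeta> w - \<psi> (-\<zeta>) w"
    using unbalanced[OF assms(1)] assms by auto
  then show "candidates w \<noteq> {}"
    unfolding candidates_def by blast
qed

lemma turn_nonzero: "w \<noteq> 0 \<Longrightarrow> turn w \<noteq> 0" "w \<noteq> 0 \<Longrightarrow> swap w \<noteq> 0"
  by (metis norm_turn(1) norm_eq_zero, metis norm_turn(3) norm_eq_zero)

lemma lab_turn:
  assumes "norm w \<le> R"
  shows "lab (turn w) = turn_label (lab w)"
proof -
  have \<psi>: "\<psi> \<zeta> (turn w) = \<psi> (\<i> * \<zeta>) w" for \<zeta>
    by (simp add: \<psi>_def box_vertex_turn)
  have sc: "s (turn w) = s w" "c (turn w) = - c w"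
    by (simp_all add: s_def c_def \<psi>)
  have "vlabel (direction (turn w)) = turn_label (vlabel (direction w))"
    if "\<bar>s w\<bar> < \<delta>" "\<bar>c w\<bar> < \<delta>"
  proof -
    note ne = candidates_nonempty[OF assms that]
    have "bij_betw ((*) \<i>) fourth_roots fourth_roots"
      by (auto simp: bij_betw_def inj_on_def fourth_roots_def)
    note * = direction_equivariant[of turn w "(*) \<i>", OF _ this _ ne(1) turn_nonzero(1)[OF ne(1)] ne(2)]
    show ?thesis using * vlabel_turn by (simp add: box_vertex_turn)
  qed
  then show ?thesis
    using \<delta> by (auto simp: lab_def sc)
qed

lemma lab_swap:
  assumes "norm w \<le> R"
  shows "lab (swap w) = swap_label (lab w)"
proof -
  have \<psi>: "\<psi> \<zeta> (swap w) = \<psi> (- cnj \<zeta>) w" for \<zeta>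
    by (simp add: \<psi>_def box_vertex_swap even)
  have sc: "s (swap w) = s w" "c (swap w) = c w"
    by (simp_all add: s_def c_def \<psi>)
  have "vlabel (direction (swap w)) = swap_label (vlabel (direction w))"
    if "\<bar>s w\<bar> < \<delta>" "\<bar>c w\<bar> < \<delta>"
  proof -
    note ne = candidates_nonempty[OF assms that]
    have "bij_betw (\<lambda>\<zeta>. - cnj \<zeta>) fourth_roots fourth_roots"
      by (auto simp: bij_betw_def inj_on_def fourth_roots_def)
    note * = direction_equivariant[of swap w "\<lambda>\<zeta>. - cnj \<zeta>", OF _ this _ ne(1) turn_nonzero(2)[OF ne(1)] ne(2)]
    show ?thesis using * vlabel_swap by (simp add: box_vertex_swap)
  qed
  then show ?thesis
    using \<delta> by (auto simp: lab_def sc)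
qed

text \<open>Each label witnesses an inequality with margin \<open>\<delta>\<close>, and opposite labels
  witness opposite inequalities.\<close>

lemma lab_cases:
  assumes "norm w \<le> R"
  obtains "lab w = SP" "\<delta> \<le> s w" | "lab w = SN" "s w \<le> - \<delta>"
    | "lab w = CP" "\<delta> \<le> c w" | "lab w = CN" "c w \<le> - \<delta>"
    | \<zeta> where "\<zeta> \<in> fourth_roots" "lab w = vlabel \<zeta>" "\<delta> \<le> \<psi> \<zeta> w - \<psi> (-\<zeta>) w"
proof (cases "\<bar>s w\<bar> < \<delta> \<and> \<bar>c w\<bar> < \<delta>")
  case True
  then have "lab w = vlabel (direction w)" by (simp add: lab_def abs_less_iff)
  then show ?thesis
    using that(5) direction[OF candidates_nonempty[OF assms]] True by blast
next
  case False
  then show ?thesis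
    using that(1-4) unfolding lab_def by (smt (verit))
qed

lemma lab_near:
  assumes "norm v \<le> R" "norm w \<le> R" "dist v w < \<eta>"
  shows "lab w \<noteq> opposite (lab v)"
proof
  assume opp: "lab w = opposite (lab v)"
  have n: "s v - s w < \<delta>" "s w - s v < \<delta>" "c v - c w < \<delta>" "c w - c v < \<delta>"
    "\<And>\<zeta>. \<zeta> \<in> fourth_roots \<Longrightarrow> \<bar>\<psi> \<zeta> v - \<psi> \<zeta> w\<bar> < \<delta>"
    using near[OF assms] by (simp_all add: abs_less_iff)
  have vv: False if "\<zeta> \<in> fourth_roots" "lab v = vlabel \<zeta>" "\<delta> \<le> \<psi> \<zeta> v - \<psi> (-\<zeta>) v"
    "\<xi> \<in> fourth_roots" "lab w = vlabel \<xi>" "\<delta> \<le> \<psi> \<xi> w - \<psi> (-\<xi>) w" for \<zeta> \<xi>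
  proof -
    have "\<xi> = - \<zeta>"
      using opp that by (intro vlabel_opposite) simp_all
    then have "\<delta> \<le> \<psi> (-\<zeta>) w - \<psi> \<zeta> w" using that(6) by simp
    then show False
      using n(5)[OF that(1)] n(5)[OF fourth_roots_minus[OF that(1)]] that(3) by linarith
  qed
  show False
    by (rule lab_cases[OF assms(1)]; rule lab_cases[OF assms(2)])
       (use opp n \<delta> vv in \<open>auto simp: vlabel_neq[symmetric]\<close>)
qed

lemma contradiction: False
proof -
  interpret equivariant_labelling lab R \<eta>
  proof
    show "lab 0 = SN" using centre \<delta> by (simp add: lab_def)
    show "lab w = SP" if "R / 4 \<le> norm w" "norm w \<le> R" for w
      using outer[OF that] by (simp add: lab_def)
  qed (use R \<eta> lab_turn lab_swap lab_near in auto)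
  show False by (rule contradiction)
qed

end

text \<open>On a ball so large that \<open>\<phi> \<ge> 1\<close> at all vertices of boxes with parameter
  in its outer part, compactness provides the margin \<open>\<delta>\<close> and uniform continuity the
  mesh \<open>\<eta>\<close> for \<open>no_balanced_box\<close>, which is contradictory.\<close>

lemma balanced_box_exists:
  fixes \<phi> :: "real^3 \<Rightarrow> real"
  assumes cont: "continuous_on UNIV \<phi>" and even: "\<And>x. \<phi> (- x) = \<phi> x"
    and centre: "\<phi> 0 < 0" and far: "\<And>x. L \<le> norm x \<Longrightarrow> 1 \<le> \<phi> x" and h: "h > 0"
  shows "\<exists>w. \<forall>\<zeta>\<in>fourth_roots. \<phi> (box_vertex w h \<zeta>) = 0"
proof (rule ccontr)
  assume no: "\<nexists>w. \<forall>\<zeta>\<in>fourth_roots. \<phi> (box_vertex w h \<zeta>) = 0"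
  define \<psi> where "\<psi> = (\<lambda>\<zeta> w. \<phi> (box_vertex w h \<zeta>))"
  define s where "s = (\<lambda>w. \<psi> 1 w + \<psi> \<i> w + \<psi> (-1) w + \<psi> (-\<i>) w)"
  define c where "c = (\<lambda>w. \<psi> 1 w - \<psi> \<i> w + \<psi> (-1) w - \<psi> (-\<i>) w)"
  \<comment> \<open>The outer region starts at norm \<open>\<bar>L\<bar> + 1\<close>, whose square is at least \<open>L\<close>.\<close>
  define R where "R = 4 * (\<bar>L\<bar> + 1)"
  have R: "R > 0" by (simp add: R_def)
  have \<psi>: "continuous_on A (\<psi> \<zeta>)" for A \<zeta>
    unfolding \<psi>_def by (rule continuous_on_compose2[OF cont continuous_on_box_vertex]) simp
  have sc: "continuous_on A s" "continuous_on A c" for A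
    unfolding s_def c_def by (intro continuous_intros \<psi>)+
  define G where "G = (\<lambda>w. \<bar>s w\<bar> + \<bar>c w\<bar> + \<bar>\<psi> 1 w - \<psi> (-1) w\<bar> + \<bar>\<psi> \<i> w - \<psi> (-\<i>) w\<bar>)"
  have G: "continuous_on (cball 0 R) G"
    unfolding G_def by (intro continuous_intros \<psi> sc)
  have "cball (0 :: complex \<times> complex) R \<noteq> {}" using R by simp
  then obtain w0 where w0: "\<And>w. w \<in> cball 0 R \<Longrightarrow> G w0 \<le> G w"
    using continuous_attains_inf[OF compact_cball _ G] by blast
  have "G w0 > 0"
  proof (rule ccontr)
    assume "\<not> 0 < G w0"
    then have "s w0 = 0" "c w0 = 0" "\<psi> 1 w0 = \<psi> (-1) w0" "\<psi> \<i> w0 = \<psi> (-\<i>) w0"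
      unfolding G_def by linarith+
    then have "\<forall>\<zeta>\<in>fourth_roots. \<psi> \<zeta> w0 = 0"
      by (auto simp: s_def c_def fourth_roots_def)
    then show False using no unfolding \<psi>_def by blast
  qed
  define \<delta> where "\<delta> = Min {1, - s 0, G w0 / 4}"
  have "box_vertex 0 h \<zeta> = 0" for \<zeta>
    using norm_box_vertex[of 0 h \<zeta>] by simp
  then have "s 0 < 0" using centre by (simp add: s_def \<psi>_def)
  with \<open>G w0 > 0\<close> have \<delta>: "\<delta> > 0" "\<delta> \<le> 1" "s 0 \<le> - \<delta>" "4 * \<delta> \<le> G w0"
    by (auto simp: \<delta>_def)
  define K where "K = (\<lambda>w. (\<psi> 1 w, \<psi> \<i> w, \<psi> (-1) w, \<psi> (-\<i>) w))"
  have "continuous_on (cball 0 R) K"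
    unfolding K_def by (intro continuous_intros \<psi>)
  then have "uniformly_continuous_on (cball 0 R) K"
    by (rule compact_uniformly_continuous) simp
  then obtain \<eta> where \<eta>: "\<eta> > 0"
    "\<And>v w. v \<in> cball 0 R \<Longrightarrow> w \<in> cball 0 R \<Longrightarrow> dist w v < \<eta> \<Longrightarrow> dist (K w) (K v) < \<delta> / 4"
    unfolding uniformly_continuous_on_def using \<delta>(1) by (metis divide_pos_pos zero_less_numeral)
  have near: "\<bar>\<psi> \<zeta> v - \<psi> \<zeta> w\<bar> < \<delta> / 4"
    if "norm v \<le> R" "norm w \<le> R" "dist v w < \<eta>" "\<zeta> \<in> fourth_roots" for v w \<zeta>
  proof -
    have "dist (\<psi> \<zeta> v) (\<psi> \<zeta> w) \<le> dist (K v) (K w)"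
      using that(4) unfolding fourth_roots_def K_def
      by (auto intro: dist_fst_le[THEN order_trans] order_trans[OF _ dist_snd_le] simp: dist_Pair_Pair
          real_le_lsqrt intro!: real_le_rsqrt)
    also have "\<dots> < \<delta> / 4" using that by (intro \<eta>(2)) auto
    finally show ?thesis by (simp add: dist_real_def)
  qed
  interpret no_balanced_box \<phi> h \<delta> R \<eta> \<psi> s c
  proof
    show "\<delta> \<le> s w" if "R / 4 \<le> norm w" for w
    proof -
      have "\<bar>L\<bar> + 1 \<le> norm w" using that by (simp add: R_def)
      then have "(\<bar>L\<bar> + 1) * 1 \<le> norm w * norm w"
        by (intro mult_mono) auto
      moreover have "1 \<le> sqrt (h\<^sup>2 + 1)" by simp
      ultimately have "(\<bar>L\<bar> + 1) * 1 * 1 \<le> norm w * norm w * sqrt (h\<^sup>2 + 1)"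
        by (rule mult_mono) auto
      then have "1 \<le> \<psi> \<zeta> w" if "norm \<zeta> = 1" for \<zeta>
        unfolding \<psi>_def using that
        by (intro far) (simp add: norm_box_vertex power2_eq_square)
      from this[of 1] this[of \<i>] this[of "-1"] this[of "-\<i>"] show ?thesis
        using \<delta>(2) by (simp add: s_def)
    qed
    show "\<delta> \<le> \<bar>s w\<bar> \<or> \<delta> \<le> \<bar>c w\<bar> \<or> (\<exists>\<zeta>\<in>fourth_roots. \<delta> \<le> \<psi> \<zeta> w - \<psi> (-\<zeta>) w)" if "norm w \<le> R" for w
    proof -
      have "4 * \<delta> \<le> G w" using \<delta>(4) w0[of w] that by simp
      then have "\<delta> \<le> \<bar>s w\<bar> \<or> \<delta> \<le> \<bar>c w\<bar> \<or> \<delta> \<le> \<bar>\<psi> 1 w - \<psi> (-1) w\<bar> \<or> \<delta> \<le> \<bar>\<psi> \<i> w - \<psi> (-\<i>) w\<bar>"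
        unfolding G_def by linarith
      then show ?thesis by (auto simp: fourth_roots_def abs_if split: if_splits)
    qed
    show "\<bar>s v - s w\<bar> < \<delta> \<and> \<bar>c v - c w\<bar> < \<delta> \<and> (\<forall>\<zeta>\<in>fourth_roots. \<bar>\<psi> \<zeta> v - \<psi> \<zeta> w\<bar> < \<delta>)"
      if "norm v \<le> R" "norm w \<le> R" "dist v w < \<eta>" for v w
    proof -
      note n = near[OF that]
      have "\<bar>\<psi> \<zeta> v - \<psi> \<zeta> w\<bar> < \<delta>" if "\<zeta> \<in> fourth_roots" for \<zeta>
        using n[OF that] \<delta>(1) by linarith
      moreover have "1 \<in> fourth_roots" "\<i> \<in> fourth_roots" "-1 \<in> fourth_roots" "-\<i> \<in> fourth_roots"
        by (simp_all add: fourth_roots_def)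
      note n[OF this(1)] n[OF this(2)] n[OF this(3)] n[OF this(4)]
      then have "\<bar>s v - s w\<bar> < \<delta>" "\<bar>c v - c w\<bar> < \<delta>"
        unfolding s_def c_def by linarith+
      ultimately show ?thesis by blast
    qed
  qed (use h R \<delta> \<eta> even in \<open>auto simp: \<psi>_def s_def c_def\<close>)
  show False by (rule contradiction)
qed

section \<open>From surfaces to even functions\<close>

lemma C1_on_imp_continuous_on:
  assumes C: "C1_on S f"
  shows "continuous_on S f"
  unfolding continuous_on_eq_continuous_within
proof
  fix x assume x: "x \<in> S"
  obtain U g g' where U: "open U" "x \<in> U"
      and g: "\<forall>y\<in>U. (g has_derivative blinfun_apply (g' y)) (at y)"
      and fg: "\<forall>y\<in>S \<inter> U. f y = g y"
    using C[unfolded C1_on_def, rule_format, OF x] by (elim exE conjE)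
  from g U(2) have "(g has_derivative blinfun_apply (g' x)) (at x)" by (rule bspec)
  then have "continuous (at x within S) g"
    by (rule continuous_at_imp_continuous_at_within[OF has_derivative_continuous])
  then have "(g \<longlongrightarrow> g x) (at x within S)"
    by (simp add: continuous_within)
  moreover have "\<forall>\<^sub>F y in at x within S. g y = f y"
    unfolding eventually_at_topological using U fg by (intro exI[of _ U]) simp
  ultimately have "(f \<longlongrightarrow> g x) (at x within S)"
    by (rule Lim_transform_eventually)
  then show "continuous (at x within S) f"
    using fg U(2) x by (simp add: continuous_within)
qed

text \<open>If 0 were in the unbounded component, then by Borsuk's criterion radial projection
  restricted to the surface would be inessential. Composing with \<open>f\<close> and following the normalised
  homotopy, the identity of the sphere would be inessential as well, and the sphere
  contractible.\<close>

lemma bounded_component_of_homotopic_sphere: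
  fixes f :: "real^3 \<Rightarrow> real^3" and H :: "(real^3) \<times> real \<Rightarrow> real^3"
  assumes H: "continuous_on (sphere 0 1 \<times> {0..1}) H"
    and nz: "\<And>u t. u \<in> sphere 0 1 \<Longrightarrow> t \<in> {0..1} \<Longrightarrow> H (u, t) \<noteq> 0"
    and H0: "\<And>u. u \<in> sphere 0 1 \<Longrightarrow> H (u, 0) = f u"
    and H1: "\<And>u. u \<in> sphere 0 1 \<Longrightarrow> H (u, 1) = u"
    and f: "continuous_on (sphere 0 1) f"
  shows "bounded (connected_component_set (- f ` sphere 0 1) 0)"
proof (rule ccontr)
  let ?S = "sphere (0::real^3) 1"
  have nz0: "f u \<noteq> 0" if "u \<in> ?S" for u
    using nz[OF that, of 0] H0[OF that] by simp
  assume "\<not> bounded (connected_component_set (- f ` ?S) 0)"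
  moreover have "compact (f ` ?S)"
    using f by (intro compact_continuous_image) auto
  moreover have "0 \<notin> f ` ?S" using nz0 by force
  ultimately obtain c where c: "homotopic_with_canon (\<lambda>x. True) (f ` ?S) ?S
      (\<lambda>x. inverse (norm (x - 0)) *\<^sub>R (x - 0)) (\<lambda>x. c)"
    using Borsuk_map_essential_bounded_component[of "f ` ?S" 0] by blast
  have "homotopic_with_canon (\<lambda>x. True) ?S ?S ((\<lambda>x. inverse (norm (x - 0)) *\<^sub>R (x - 0)) \<circ> f) ((\<lambda>x. c) \<circ> f)"
    using c f by (intro homotopic_with_compose_continuous_right[where X = "f ` ?S"]) auto
  then have 1: "homotopic_with_canon (\<lambda>x. True) ?S ?S (\<lambda>u. inverse (norm (f u)) *\<^sub>R f u) (\<lambda>x. c)"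
    by (simp add: o_def)
  have "homotopic_with_canon (\<lambda>x. True) ?S ?S (\<lambda>u. inverse (norm (f u)) *\<^sub>R f u) (\<lambda>u. u)"
  proof -
    define K where "K = (\<lambda>z. inverse (norm (H (snd z, fst z))) *\<^sub>R H (snd z, fst z))"
    have sw: "continuous_on ({0..1} \<times> ?S) (\<lambda>z. H (snd z, fst z))"
    proof (rule continuous_on_compose2[OF H])
      show "continuous_on ({0..1} \<times> ?S) (\<lambda>z. (snd z, fst z))"
        by (intro continuous_intros)
    qed auto
    have "continuous_on ({0..1} \<times> ?S) K"
      unfolding K_def using nz by (intro continuous_intros sw) auto
    moreover have "K ` ({0..1} \<times> ?S) \<subseteq> ?S"
      using nz by (auto simp: K_def)
    moreover have "K (0, u) = inverse (norm (f u)) *\<^sub>R f u" "K (1, u) = u" if "u \<in> ?S" for u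
      using that H0 H1 by (auto simp: K_def)
    ultimately have K: "continuous_map (top_of_set ({0..1} \<times> ?S)) (top_of_set ?S) K"
      "\<forall>u\<in>?S. K (0, u) = inverse (norm (f u)) *\<^sub>R f u" "\<forall>u\<in>?S. K (1, u) = u"
      unfolding continuous_map_subtopology_eu by blast+
    have "continuous_map (prod_topology (top_of_set {0..1}) (top_of_set ?S)) (top_of_set ?S) K"
      using K(1) by (simp only: subtopology_Times[symmetric] prod_topology_euclidean)
    with K(2,3) show ?thesis
      by (subst homotopic_with, simp) (intro exI[of _ K], simp)
  qed
  then have "homotopic_with_canon (\<lambda>x. True) ?S ?S (\<lambda>u. u) (\<lambda>x. c)"
    using 1 by (rule homotopic_with_trans[OF homotopic_with_symD])
  then have "contractible ?S"
    unfolding contractible_def id_def by blast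
  then show False by (simp add: contractible_sphere)
qed

definition signed_dist :: "'a::euclidean_space set \<Rightarrow> 'a \<Rightarrow> real" where
  "signed_dist S x = (if x \<in> connected_component_set (- S) 0 then - infdist x S else infdist x S)"

text \<open>A segment that leaves the component of 0 crosses \<open>S\<close>, so the distances of its ends from
  \<open>S\<close> add up to at most its length; this is what makes the change of sign continuous.\<close>

lemma signed_dist_lipschitz:
  fixes S :: "'a::euclidean_space set"
  assumes "S \<noteq> {}"
  shows "\<bar>signed_dist S x - signed_dist S y\<bar> \<le> dist x y"
proof -
  have opp: "infdist a S + infdist b S \<le> dist a b"
    if "a \<in> connected_component_set (- S) 0" "b \<notin> connected_component_set (- S) 0" for a b
  proof -
    have "\<not> closed_segment a b \<subseteq> - S"
    proof
      assume "closed_segment a b \<subseteq> - S"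
      then have "connected_component (- S) a b"
        unfolding connected_component_def by (intro exI[of _ "closed_segment a b"]) auto
      moreover have "connected_component (- S) 0 a" "\<not> connected_component (- S) 0 b"
        using that by auto
      ultimately show False using connected_component_trans by blast
    qed
    then obtain z where z: "z \<in> closed_segment a b" "z \<in> S" by auto
    have "infdist a S \<le> dist a z" "infdist b S \<le> dist b z"
      using z by (auto intro: infdist_le)
    moreover have "dist a b = dist a z + dist b z"
      using z(1) between[of a b z] by (simp add: between_mem_segment dist_commute)
    ultimately show ?thesis by simp
  qed
  have "\<bar>infdist x S - infdist y S\<bar> \<le> dist x y"
    using infdist_triangle_abs[of x S y] by simp
  moreover have "dist y x = dist x y" by (rule dist_commute)
  ultimately show ?thesis
    using opp[of x y] opp[of y x] infdist_nonneg[of x S] infdist_nonneg[of y S]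
    unfolding signed_dist_def by (simp split: if_split; linarith)
qed

lemma signed_dist_continuous:
  fixes S :: "'a::euclidean_space set"
  assumes "S \<noteq> {}"
  shows "continuous_on UNIV (signed_dist S)"
  unfolding continuous_on_iff dist_real_def
proof (intro ballI allI impI)
  fix x and e :: real assume "e > 0"
  moreover have "\<bar>signed_dist S y - signed_dist S x\<bar> < e" if "dist y x < e" for y
    using signed_dist_lipschitz[OF assms, of y x] that by linarith
  ultimately show "\<exists>d>0. \<forall>y\<in>UNIV. dist y x < d \<longrightarrow> \<bar>signed_dist S y - signed_dist S x\<bar> < e"
    by blast
qed

lemma signed_dist_even:
  assumes "\<And>x. x \<in> S \<Longrightarrow> - x \<in> S"
  shows "signed_dist S (- x) = signed_dist S x"
proof -
  have S: "uminus ` S = S"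
    using assms by (auto simp: image_iff intro!: bexI[of _ "- _"])
  have inf: "infdist (- x) S = infdist x S" for x
  proof -
    have "infdist (- x) S = infdist (- x) (uminus ` S)" by (simp only: S)
    also have "\<dots> = infdist x S"
      unfolding infdist_def by (simp add: image_image dist_norm norm_minus_commute)
    finally show ?thesis .
  qed
  have *: "- x \<in> connected_component_set (- S) 0" if x: "x \<in> connected_component_set (- S) 0" for x
  proof -
    obtain T where T: "connected T" "T \<subseteq> - S" "0 \<in> T" "x \<in> T"
      using x by (auto simp: connected_component_def)
    have "connected (uminus ` T)"
      using T(1) by (intro connected_continuous_image continuous_on_minus continuous_on_id)
    moreover have "uminus ` T \<subseteq> - S" using T(2) assms by (metis (no_types, lifting) Compl_iff image_subset_iff minus_minus subsetD)
    ultimately show ?thesis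
      using T(3,4) by (simp add: connected_component_def) (intro exI[of _ "uminus ` T"], force)
  qed
  have "- x \<in> connected_component_set (- S) 0 \<longleftrightarrow> x \<in> connected_component_set (- S) 0"
    using *[of x] *[of "- x"] by auto
  with inf show ?thesis
    by (simp only: signed_dist_def)
qed

lemma signed_dist_eq_0: "closed S \<Longrightarrow> S \<noteq> {} \<Longrightarrow> signed_dist S x = 0 \<longleftrightarrow> x \<in> S"
  using in_closed_iff_infdist_zero[of S x] by (simp add: signed_dist_def)

section \<open>Inscribed boxes\<close>

lemma extreme_point_of_cbox_cart:
  fixes x :: "real^'n"
  assumes "x extreme_point_of cbox a b"
  shows "x $ i = a $ i \<or> x $ i = b $ i"
proof (rule ccontr)
  assume ne: "\<not> (x $ i = a $ i \<or> x $ i = b $ i)"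
  have x: "\<forall>j. a $ j \<le> x $ j \<and> x $ j \<le> b $ j"
    using assms by (simp add: extreme_point_of_def mem_box_cart)
  define e where "e = min (x $ i - a $ i) (b $ i - x $ i)"
  have e: "e > 0" "e \<le> x $ i - a $ i" "e \<le> b $ i - x $ i"
    using ne x[rule_format, of i] by (auto simp: e_def)
  define d where "d = axis i e"
  have d: "d $ j = (if j = i then e else 0)" for j by (simp add: d_def axis_def)
  have "x - d \<in> cbox a b" "x + d \<in> cbox a b"
    using x e by (auto simp: mem_box_cart d)
  moreover have "x = midpoint (x - d) (x + d)"
    by (simp add: midpoint_def flip: scaleR_2)
  moreover have "(x - d) $ i \<noteq> (x + d) $ i" using e by (simp add: d)
  then have "x - d \<noteq> x + d" by metis
  then have "x \<in> open_segment (x - d) (x + d)"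
    using midpoint_in_open_segment[of "x - d" "x + d"] calculation(3) by simp
  ultimately show False
    using assms unfolding extreme_point_of_def by blast
qed


text \<open>Dividing by \<open>|w|\<^sup>2\<close> turns the similarity into an orthogonal map. The vertices are
  given in a frame along the diagonals of the base, while the edges of a box are parallel to
  the coordinate axes before the orthogonal map is applied; multiplication by
  \<open>\<epsilon> = exp (- i \<pi> / 4)\<close> turns one frame into the other. The base edge is then
  \<open>\<surd>2 |w|\<^sup>2\<close>, and the ratio \<open>q\<close> corresponds to \<open>h = q / \<surd>2\<close>.\<close>

lemma box_of_balanced_point:
  assumes S: "\<And>x. x \<in> S \<Longrightarrow> - x \<in> S" and q: "q > 0"
    and w: "\<forall>\<zeta>\<in>fourth_roots. box_vertex w (q / sqrt 2) \<zeta> \<in> S" "w \<noteq> 0"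
  shows "\<exists>B. square_based_box q 0 B \<and> vertices B \<subseteq> S"
proof -
  define r where "r = (norm w)\<^sup>2"
  define \<epsilon> where "\<epsilon> = (1 - \<i>) / of_real (sqrt 2)"
  define T where "T = (\<lambda>x::real^3. (1 / r) *\<^sub>R box_vertex w (x $ 3) (Complex (x $ 1) (x $ 2) * \<epsilon>))"
  define a where "a = sqrt 2 * r"
  have r: "r > 0" using w(2) by (simp add: r_def)
  have \<epsilon>: "norm \<epsilon> = 1"
    by (simp add: \<epsilon>_def norm_divide cmod_def power_divide)
  have "linear T"
  proof (rule linearI)
    fix x y :: "real^3" and k :: real
    have "Complex ((x + y) $ 1) ((x + y) $ 2) * \<epsilon> = Complex (x $ 1) (x $ 2) * \<epsilon> + Complex (y $ 1) (y $ 2) * \<epsilon>"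
      by (simp add: algebra_simps flip: complex_add)
    then show "T (x + y) = T x + T y"
      by (simp add: T_def box_vertex_add scaleR_add_right)
    have k: "Complex ((k *\<^sub>R x) $ 1) ((k *\<^sub>R x) $ 2) * \<epsilon> = of_real k * (Complex (x $ 1) (x $ 2) * \<epsilon>)"
      by (simp add: complex_eq_iff algebra_simps)
    have "T (k *\<^sub>R x) = (1 / r) *\<^sub>R box_vertex w ((k *\<^sub>R x) $ 3) (of_real k * (Complex (x $ 1) (x $ 2) * \<epsilon>))"
      by (simp only: T_def k)
    also have "\<dots> = k *\<^sub>R T x"
      by (simp add: T_def box_vertex_scale)
    finally show "T (k *\<^sub>R x) = k *\<^sub>R T x" .
  qed
  moreover have "norm (T x) = norm x" for x
  proof -
    have "norm (T x) = sqrt ((x $ 3)\<^sup>2 + (norm (Complex (x $ 1) (x $ 2)))\<^sup>2)"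
      using r by (simp add: T_def norm_box_vertex norm_mult \<epsilon> r_def)
    then show ?thesis
      by (simp add: norm_vec_def L2_set_def sum_3 cmod_power2 add_ac)
  qed
  ultimately have T: "orthogonal_transformation T"
    by (simp add: orthogonal_transformation)
  define l where "l = (vector [a, a, q * a] :: real^3)"
  define C where "C = cbox (- ((1/2) *\<^sub>R l)) ((1/2) *\<^sub>R l)"
  have "is_box 0 l (T ` C)"
    using T q r unfolding is_box_def C_def
    by (auto simp: l_def a_def forall_3 intro!: exI[of _ T])
  then have box: "square_based_box q 0 (T ` C)"
    using r by (auto simp: square_based_box_def l_def a_def intro!: exI[of _ "sqrt 2 * r"])
  have in_S: "T x \<in> S" if x: "x extreme_point_of C" for x
  proof -
    have coord: "x $ i = - (l $ i / 2) \<or> x $ i = l $ i / 2" for i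
      using extreme_point_of_cbox_cart[OF x[unfolded C_def], of i] by simp
    define k where "k = 1 / sqrt 2"
    have k: "k * k = 1 / 2" "\<epsilon> = Complex k (- k)" "a = 2 * r * k" "q / sqrt 2 = q * k"
      by (simp_all add: k_def \<epsilon>_def a_def complex_eq_iff field_simps)
    obtain \<sigma> \<tau> \<rho> where signs: "\<sigma> \<in> {1, -1}" "\<tau> \<in> {1, -1}" "\<rho> \<in> {1, -1}"
      and x123: "x $ 1 = \<sigma> * (r * k)" "x $ 2 = \<tau> * (r * k)" "x $ 3 = \<rho> * (q * r * k)"
    proof -
      define \<sigma> :: "3 \<Rightarrow> real" where "\<sigma> i = (if x $ i = l $ i / 2 then 1 else -1)" for i
      have \<sigma>: "\<sigma> i \<in> {1, -1}" "x $ i = \<sigma> i * (l $ i / 2)" for i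
        using coord[of i] by (auto simp: \<sigma>_def)
      have l: "l $ 1 / 2 = r * k" "l $ 2 / 2 = r * k" "l $ 3 / 2 = q * r * k"
        by (simp_all add: l_def k(3))
      show ?thesis
        using that[OF \<sigma>(1) \<sigma>(1) \<sigma>(1) \<sigma>(2)[of 1, unfolded l] \<sigma>(2)[of 2, unfolded l] \<sigma>(2)[of 3, unfolded l]] .
    qed
    have "T x = box_vertex w (1 / r * x $ 3) (of_real (1 / r) * (Complex (x $ 1) (x $ 2) * \<epsilon>))"
      unfolding T_def box_vertex_scale ..
    moreover have "of_real (1 / r) * (Complex (x $ 1) (x $ 2) * \<epsilon>) = Complex ((\<sigma> + \<tau>) / 2) ((\<tau> - \<sigma>) / 2)"
    proof -
      have "Complex (x $ 1) (x $ 2) * \<epsilon> = Complex (r * (\<sigma> + \<tau>) * (k * k)) (r * (\<tau> - \<sigma>) * (k * k))"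
        by (simp add: k(2) x123 complex_eq_iff algebra_simps)
      then show ?thesis
        unfolding k(1) using r by (simp add: complex_eq_iff)
    qed
    moreover have "1 / r * x $ 3 = \<rho> * (q / sqrt 2)"
      using r by (simp add: x123 k(4))
    ultimately have Tx: "T x = box_vertex w (\<rho> * (q / sqrt 2)) (of_real \<rho> * (of_real \<rho> * Complex ((\<sigma> + \<tau>) / 2) ((\<tau> - \<sigma>) / 2)))"
      using signs(3) by auto
    have "Complex ((\<sigma> + \<tau>) / 2) ((\<tau> - \<sigma>) / 2) \<in> fourth_roots"
      using signs(1,2) by (auto simp: fourth_roots_def complex_eq_iff)
    then have "of_real \<rho> * Complex ((\<sigma> + \<tau>) / 2) ((\<tau> - \<sigma>) / 2) \<in> fourth_roots"
      using signs(3) fourth_roots_minus by auto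
    then have "box_vertex w (q / sqrt 2) (of_real \<rho> * Complex ((\<sigma> + \<tau>) / 2) ((\<tau> - \<sigma>) / 2)) \<in> S"
      using w(1) by blast
    moreover have "\<rho> *\<^sub>R y \<in> S" if "y \<in> S" for y
      using signs(3) that S by auto
    ultimately show ?thesis
      unfolding Tx box_vertex_scale by blast
  qed
  have preimage: "x extreme_point_of C" if "T x extreme_point_of T ` C" for x
  proof -
    have T': "linear T" "inj T"
      using T by (simp_all add: orthogonal_transformation_linear orthogonal_transformation_inj)
    show ?thesis
      unfolding extreme_point_of_def
    proof (intro conjI ballI notI)
      show "x \<in> C"
        using that T'(2) by (auto simp: extreme_point_of_def inj_def)
      fix y z assume yz: "y \<in> C" "z \<in> C" "x \<in> open_segment y z"
      have "T x \<in> open_segment (T y) (T z)"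
        unfolding open_segment_linear_image[OF T'] using yz(3) by (rule imageI)
      moreover have "T y \<in> T ` C" "T z \<in> T ` C" using yz by simp_all
      ultimately show False
        using that unfolding extreme_point_of_def by blast
    qed
  qed
  have "vertices (T ` C) \<subseteq> S"
  proof
    fix y assume "y \<in> vertices (T ` C)"
    then have y: "y extreme_point_of T ` C" by (simp add: vertices_def)
    then obtain x where "y = T x" by (auto simp: extreme_point_of_def)
    with y show "y \<in> S" using in_S preimage by simp
  qed
  with box show ?thesis by blast
qed

theorem theorem16:
  fixes f :: "real^3 \<Rightarrow> real^3"
    and H :: "(real^3) \<times> real \<Rightarrow> real^3"
    and q :: real
  assumes "C1_embedding_sphere f"
    and "\<And>u. u \<in> sphere 0 1 \<Longrightarrow> f (- u) = - f u"
    and "C1_on (sphere 0 1 \<times> {0..1}) H"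
    and "\<And>u t. u \<in> sphere 0 1 \<Longrightarrow> t \<in> {0..1} \<Longrightarrow> H (u, t) \<noteq> 0"
    and "\<And>u. u \<in> sphere 0 1 \<Longrightarrow> H (u, 0) = f u"
    and "\<And>u. u \<in> sphere 0 1 \<Longrightarrow> H (u, 1) = u"
    and "\<And>u t. u \<in> sphere 0 1 \<Longrightarrow> t \<in> {0..1} \<Longrightarrow> H (- u, t) = - H (u, t)"
    and "q > 0"
  shows "\<exists>B. square_based_box q 0 B \<and> vertices B \<subseteq> f ` sphere 0 1"
proof -
  let ?S = "f ` sphere 0 1"
  have f: "continuous_on (sphere 0 1) f"
    using assms(1) by (simp add: C1_embedding_sphere_def C1_on_imp_continuous_on)
  then have compact: "compact ?S"
    by (intro compact_continuous_image) auto
  have ne: "?S \<noteq> {}" by simp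
  have sym: "- x \<in> ?S" if x: "x \<in> ?S" for x
  proof -
    obtain u where "u \<in> sphere 0 1" "x = f u" using x by auto
    then show ?thesis using assms(2)[of u] by (intro image_eqI[of _ _ "- u"]) auto
  qed
  have "H (u, 0) \<noteq> 0" if "u \<in> sphere 0 1" for u
    using assms(4)[OF that, of 0] by simp
  then have zero: "0 \<notin> ?S"
    using assms(5) by force
  have "bounded (connected_component_set (- ?S) 0)"
    using assms(4-6) f C1_on_imp_continuous_on[OF assms(3)]
    by (intro bounded_component_of_homotopic_sphere[of H]) auto
  then have "bounded (connected_component_set (- ?S) 0 \<union> ?S)"
    using compact_imp_bounded[OF compact] by simp
  then obtain L where L: "\<And>x. x \<in> connected_component_set (- ?S) 0 \<union> ?S \<Longrightarrow> norm x \<le> L"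
    unfolding bounded_iff by blast
  have far: "1 \<le> signed_dist ?S x" if x: "L + 1 \<le> norm x" for x
  proof -
    have "x \<notin> connected_component_set (- ?S) 0"
      using L[of x] x by auto
    moreover have "1 \<le> infdist x ?S"
      unfolding infdist_notempty[OF ne]
    proof (rule cINF_greatest[OF ne])
      fix y assume "y \<in> ?S"
      then have "norm y \<le> L" using L by blast
      then show "1 \<le> dist x y"
        using x norm_triangle_ineq2[of x y] by (simp add: dist_norm)
    qed
    ultimately show ?thesis by (simp add: signed_dist_def)
  qed
  have "0 < infdist 0 ?S"
    using zero ne compact by (intro infdist_pos_not_in_closed compact_imp_closed)
  then have centre: "signed_dist ?S 0 < 0"
    using zero by (simp add: signed_dist_def)
  have h: "0 < q / sqrt 2" using assms(8) by simp
  obtain w where w: "\<forall>\<zeta>\<in>fourth_roots. signed_dist ?S (box_vertex w (q / sqrt 2) \<zeta>) = 0"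
    using balanced_box_exists[OF signed_dist_continuous[OF ne] signed_dist_even[OF sym] centre far h] by blast
  have "w \<noteq> 0"
  proof
    assume "w = 0"
    then have "box_vertex w (q / sqrt 2) 1 = 0" using norm_box_vertex[of 0 "q / sqrt 2" 1] by simp
    then show False using w centre by (auto simp: fourth_roots_def)
  qed
  moreover have "\<forall>\<zeta>\<in>fourth_roots. box_vertex w (q / sqrt 2) \<zeta> \<in> ?S"
    using w signed_dist_eq_0[OF compact_imp_closed[OF compact] ne] by blast
  ultimately show ?thesis
    using sym assms(8) by (intro box_of_balanced_point) auto
qed

end
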